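(* Every proper relaxation for uniform capacitated facility location (CFL) (respectively uniform lower-bounded facility location (LBFL)) with complexity $\alpha<1$ has an unbounded integrality gap. There is a proper relaxation for CFL (respectively LBFL) of complexity $1$ whose projection to $(y,x)$ expresses the integral polytope.
   Context: CFL: each open facility serves at most $U$ unit-demand clients; LBFL: each open facility must serve at least $B$ unit-demand clients; costs are opening costs $f_i$ plus metric connection costs $c_{ij}$. A class is a $0$-$1$ vector $(y,x)$ over facility variables $y_i$ and assignment variables $x_{ij}$ with $y_i\ge x_{ij}$; its cost is $c_{cl}=\sum_{i:y_i=1}f_i+\sum_{(i,j):x_{ij}=1}c_{ij}$, its assignments are $Agn_{cl}=\{(i,j):x_{ij}=1\}$, and $F(cl)=\{i:y_i=1\}$. For a set $\mathcal C$ of classes, the constellation LP is $\min\{\sum_{cl\in\mathcal C}c_{cl}x_{cl} : \sum_{cl:\exists i,(i,j)\in Agn_{cl}}x_{cl}=1\ \forall j\in C;\ \sum_{cl: i\in F(cl)}x_{cl}\le 1\ \forall i\in F;\ x_{cl}\ge0\}$; its projection to $(y,x)$ sets $y_i=\sum_{cl:i\in F(cl)}x_{cl}$ and $x_{ij}=\sum_{cl:(i,j)\in Agn_{cl}}x_{cl}$. A proper relaxation is a constellation LP that is valid (contains all integral feasible solutions) and symmetric (for every class in $\mathcal C$, all classes obtained by relabeling facilities and/or clients are also in $\mathcal C$). Its complexity is $\alpha=\sup_{cl\in\mathcal C}|F(cl)|/|F'|$, where $F'$ is a maximum-cardinality set of open facilities in an integral feasible solution. *)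

theory Defs
  imports Complex_Main "HOL-Library.Extended_Real" "HOL-Combinatorics.Permutations"
begin

datatype variant = CFL | LBFL

text \<open>
  Facilities are \<open>{..<nfac I}\<close>, clients are \<open>{..<ncli I}\<close>. The field \<open>bnd\<close> is the capacity
  \<open>U\<close> for \<open>CFL\<close> and the lower bound \<open>B\<close> for \<open>LBFL\<close>.
\<close>

record inst =
  nfac :: nat
  ncli :: nat
  bnd :: nat
  fcost :: "nat \<Rightarrow> real"
  ccost :: "nat \<Rightarrow> nat \<Rightarrow> real"

text \<open>
  Connection costs come from a distance on the disjoint union of facilities (\<open>Inl\<close>) and
  clients (\<open>Inr\<close>). As usual in facility location, distinct points may be at distance 0
  (co-located facilities and clients), so this is a pseudometric; nonnegativity follows from
  the three conditions.
\<close>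

definition sites :: "inst \<Rightarrow> (nat + nat) set" where
  "sites I = {..<nfac I} <+> {..<ncli I}"

definition metric_costs :: "inst \<Rightarrow> bool" where
  "metric_costs I \<longleftrightarrow>
    (\<exists>d :: nat + nat \<Rightarrow> nat + nat \<Rightarrow> real.
      (\<forall>p\<in>sites I. d p p = 0) \<and>
      (\<forall>p\<in>sites I. \<forall>q\<in>sites I. d p q = d q p) \<and>
      (\<forall>p\<in>sites I. \<forall>q\<in>sites I. \<forall>r\<in>sites I. d p r \<le> d p q + d q r) \<and>
      (\<forall>i<nfac I. \<forall>j<ncli I. ccost I i j = d (Inl i) (Inr j)))"

definition wf_inst :: "inst \<Rightarrow> bool" where
  "wf_inst I \<longleftrightarrow> 1 \<le> nfac I \<and> 1 \<le> ncli I \<and> 1 \<le> bnd I \<and>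
    (\<forall>i<nfac I. 0 \<le> fcost I i) \<and> metric_costs I"

text \<open>
  Vectors \<open>(y, x)\<close>. Coordinates outside the index range of the instance are required to be 0,
  so that a vector is determined by its relevant coordinates.
\<close>

type_synonym vec = "(nat \<Rightarrow> real) \<times> (nat \<Rightarrow> nat \<Rightarrow> real)"

definition is_class :: "inst \<Rightarrow> vec \<Rightarrow> bool" where
  "is_class I = (\<lambda>(y, x).
    (\<forall>i. y i \<in> {0, 1}) \<and> (\<forall>i j. x i j \<in> {0, 1}) \<and>
    (\<forall>i. nfac I \<le> i \<longrightarrow> y i = 0) \<and>
    (\<forall>i j. nfac I \<le> i \<or> ncli I \<le> j \<longrightarrow> x i j = 0) \<and>
    (\<forall>i j. x i j \<le> y i))"

definition facs :: "vec \<Rightarrow> nat set" where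
  "facs cl = {i. fst cl i = 1}"

definition agn :: "vec \<Rightarrow> (nat \<times> nat) set" where
  "agn cl = {(i, j). snd cl i j = 1}"

definition class_cost :: "inst \<Rightarrow> vec \<Rightarrow> real" where
  "class_cost I cl = (\<Sum>i\<in>facs cl. fcost I i) + (\<Sum>(i, j)\<in>agn cl. ccost I i j)"

text \<open>Integral feasible solutions.\<close>

definition load_ok :: "variant \<Rightarrow> nat \<Rightarrow> real \<Rightarrow> bool" where
  "load_ok k b l = (case k of CFL \<Rightarrow> l \<le> real b | LBFL \<Rightarrow> real b \<le> l)"

definition int_solutions :: "variant \<Rightarrow> inst \<Rightarrow> vec set" where
  "int_solutions k I = {(y, x). is_class I (y, x) \<and>
    (\<forall>j<ncli I. (\<Sum>i<nfac I. x i j) = 1) \<and>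
    (\<forall>i<nfac I. y i = 1 \<longrightarrow> load_ok k (bnd I) (\<Sum>j<ncli I. x i j))}"

definition instances :: "variant \<Rightarrow> inst set" where
  "instances k = {I. wf_inst I \<and> int_solutions k I \<noteq> {}}"

definition int_opt :: "variant \<Rightarrow> inst \<Rightarrow> ereal" where
  "int_opt k I = (INF s\<in>int_solutions k I. ereal (class_cost I s))"

definition integral_polytope :: "variant \<Rightarrow> inst \<Rightarrow> vec set" where
  "integral_polytope k I =
    {(\<lambda>i. \<Sum>s\<in>int_solutions k I. u s * fst s i,
      \<lambda>i j. \<Sum>s\<in>int_solutions k I. u s * snd s i j) | u.
      (\<forall>s\<in>int_solutions k I. 0 \<le> u s) \<and> (\<Sum>s\<in>int_solutions k I. u s) = 1}"

text \<open>The constellation LP of a set \<open>C\<close> of classes.\<close>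

definition lp_feasible :: "inst \<Rightarrow> vec set \<Rightarrow> (vec \<Rightarrow> real) \<Rightarrow> bool" where
  "lp_feasible I C w \<longleftrightarrow>
    (\<forall>j<ncli I. (\<Sum>cl | cl \<in> C \<and> (\<exists>i. (i, j) \<in> agn cl). w cl) = 1) \<and>
    (\<forall>i<nfac I. (\<Sum>cl | cl \<in> C \<and> i \<in> facs cl. w cl) \<le> 1) \<and>
    (\<forall>cl\<in>C. 0 \<le> w cl)"

definition lp_opt :: "inst \<Rightarrow> vec set \<Rightarrow> ereal" where
  "lp_opt I C = (INF w\<in>{w. lp_feasible I C w}. ereal (\<Sum>cl\<in>C. class_cost I cl * w cl))"

definition proj :: "vec set \<Rightarrow> (vec \<Rightarrow> real) \<Rightarrow> vec" where
  "proj C w =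
    (\<lambda>i. \<Sum>cl | cl \<in> C \<and> i \<in> facs cl. w cl,
     \<lambda>i j. \<Sum>cl | cl \<in> C \<and> (i, j) \<in> agn cl. w cl)"

definition lp_projection :: "inst \<Rightarrow> vec set \<Rightarrow> vec set" where
  "lp_projection I C = proj C ` {w. lp_feasible I C w}"

definition valid :: "variant \<Rightarrow> inst \<Rightarrow> vec set \<Rightarrow> bool" where
  "valid k I C \<longleftrightarrow> int_solutions k I \<subseteq> lp_projection I C"

definition relabel :: "(nat \<Rightarrow> nat) \<Rightarrow> (nat \<Rightarrow> nat) \<Rightarrow> vec \<Rightarrow> vec" where
  "relabel p q cl = (\<lambda>i. fst cl (p i), \<lambda>i j. snd cl (p i) (q j))"

definition symmetric :: "inst \<Rightarrow> vec set \<Rightarrow> bool" where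
  "symmetric I C \<longleftrightarrow>
    (\<forall>p q. p permutes {..<nfac I} \<longrightarrow> q permutes {..<ncli I} \<longrightarrow>
      (\<forall>cl\<in>C. relabel p q cl \<in> C))"

definition proper :: "variant \<Rightarrow> inst \<Rightarrow> vec set \<Rightarrow> bool" where
  "proper k I C \<longleftrightarrow> (\<forall>cl\<in>C. is_class I cl) \<and> valid k I C \<and> symmetric I C"

definition max_open :: "variant \<Rightarrow> inst \<Rightarrow> nat" where
  "max_open k I = Max ((\<lambda>s. card (facs s)) ` int_solutions k I)"

definition complexity :: "variant \<Rightarrow> inst \<Rightarrow> vec set \<Rightarrow> real" where
  "complexity k I C = (SUP cl\<in>C. real (card (facs cl)) / real (max_open k I))"

text \<open>
  A relaxation of the problem assigns a set of classes to each instance; its integrality gap is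
  the supremum, over all feasible instances, of the ratio of the integral to the fractional
  optimum. In \<^typ>\<open>ereal\<close>, \<open>a / 0 = \<infinity>\<close> for \<open>a > 0\<close> and \<open>0 / 0 = 0\<close>.

  The complexity of a relaxation is a quantity of each instance. It cannot be below 1 on
  all instances: a valid set of classes has complexity at least \<open>1 / max_open k I\<close>, hence
  at least 1 when \<open>max_open k I = 1\<close>. So a relaxation counts as having complexity below 1 when
  this holds on all instances in which sufficiently many facilities can be opened. This
  includes every relaxation whose complexity is at most a constant \<open>\<alpha> < 1\<close> on those instances.
\<close>

type_synonym relaxation = "inst \<Rightarrow> vec set"

definition proper_relaxation :: "variant \<Rightarrow> relaxation \<Rightarrow> bool" where
  "proper_relaxation k R \<longleftrightarrow> (\<forall>I\<in>instances k. proper k I (R I))"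

definition complexity_below_one :: "variant \<Rightarrow> relaxation \<Rightarrow> bool" where
  "complexity_below_one k R \<longleftrightarrow>
    (\<exists>N. \<forall>I\<in>instances k. N \<le> max_open k I \<longrightarrow> complexity k I (R I) < 1)"

definition complexity_one :: "variant \<Rightarrow> relaxation \<Rightarrow> bool" where
  "complexity_one k R \<longleftrightarrow> (\<forall>I\<in>instances k. complexity k I (R I) = 1)"

definition integrality_gap :: "variant \<Rightarrow> relaxation \<Rightarrow> ereal" where
  "integrality_gap k R = (SUP I\<in>instances k. int_opt k I / lp_opt I (R I))"

end

theory Submission
  imports Defs
begin

text \<open>
  If \<open>s\<close> is an integral solution in the projection of the constellation LP, then every class of
  positive weight in a fractional decomposition of \<open>s\<close> is the restriction of \<open>s\<close> to some set of
  facilities. When \<open>s\<close> opens the maximum number of facilities and the complexity is below 1, all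
  these sets are proper. As every open facility has total weight 1, some nonempty set then misses
  any prescribed facility. Take \<open>s\<close> in which all facilities but one have load exactly \<open>U\<close>
  (respectively \<open>B\<close>) and let the exceptional facility be missed: by symmetry, for some \<open>t\<close>
  below the maximum, every class with \<open>t\<close> facilities of load exactly \<open>U\<close> (\<open>B\<close>) is available.

  For CFL with \<open>z + 1\<close> facilities, \<open>z U + 1\<close> clients and a single facility of cost 1 (all other
  costs 0), such classes open the costly facility to extent \<open>1 / U\<close> only, whereas every integral
  solution opens it. For LBFL with \<open>z + 2\<close> facilities at distance 1, \<open>B - 1\<close> clients at each and
  \<open>z + 1\<close> clients at a hub, every integral solution closes a facility and pays at least \<open>B - 1\<close>,
  whereas such classes open every facility almost fully at cost at most \<open>z + 2\<close>.

  The integral solutions themselves, taken as classes, give the relaxation of complexity 1: every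
  class covers every client, so the LP solutions are exactly the convex combinations.
\<close>

section \<open>Classes and integral solutions\<close>

text \<open>A 0-1 vector is determined by its open facilities and its assignments, which lie in
  finite sets. Finiteness matters throughout: a sum over an infinite set is 0 by convention, which
  would empty the LP constraints of meaning.\<close>

lemma finite_classes: "finite {cl. is_class I cl}"
proof -
  let ?h = "\<lambda>cl. (facs cl, agn cl)"
  have "inj_on ?h {cl. is_class I cl}"
  proof (rule inj_onI)
    fix c d assume c: "c \<in> {cl. is_class I cl}" and d: "d \<in> {cl. is_class I cl}"
      and eq: "?h c = ?h d"
    obtain y x y' x' where [simp]: "c = (y, x)" "d = (y', x')"
      by (cases c, cases d) auto
    have "y i = y' i" for i
    proof -
      have "y i \<in> {0,1}" "y' i \<in> {0,1}" using c d by (auto simp: is_class_def)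
      moreover have "y i = 1 \<longleftrightarrow> y' i = 1" using eq by (auto simp: facs_def)
      ultimately show ?thesis by auto
    qed
    moreover have "x i j = x' i j" for i j
    proof -
      have "x i j \<in> {0,1}" "x' i j \<in> {0,1}" using c d by (auto simp: is_class_def)
      moreover have "x i j = 1 \<longleftrightarrow> x' i j = 1" using eq by (auto simp: agn_def)
      ultimately show ?thesis by auto
    qed
    ultimately show "c = d" by (simp add: fun_eq_iff)
  qed
  moreover have "?h ` {cl. is_class I cl} \<subseteq> Pow {..<nfac I} \<times> Pow ({..<nfac I} \<times> {..<ncli I})"
    by (force simp: is_class_def facs_def agn_def not_le[symmetric])
  then have "finite (?h ` {cl. is_class I cl})"
    by (rule finite_subset) auto
  ultimately show ?thesis using finite_imageD by blast
qed

lemma finite_proper: "proper k I C \<Longrightarrow> finite C"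
  by (rule finite_subset[OF _ finite_classes[of I]]) (auto simp: proper_def)

lemma int_solution_is_class: "s \<in> int_solutions k I \<Longrightarrow> is_class I s"
  by (auto simp: int_solutions_def)

lemma finite_int_solutions: "finite (int_solutions k I)"
  by (rule finite_subset[OF _ finite_classes[of I]]) (auto intro: int_solution_is_class)

lemma facs_subset: "is_class I cl \<Longrightarrow> facs cl \<subseteq> {..<nfac I}"
  by (force simp: is_class_def facs_def not_le[symmetric])

lemma agn_subset: "is_class I cl \<Longrightarrow> agn cl \<subseteq> facs cl \<times> {..<ncli I}"
proof
  fix e assume cl: "is_class I cl" and "e \<in> agn cl"
  then obtain i j where e: "e \<in> agn cl" "e = (i, j)" by (cases e) auto
  have x: "snd cl i j = 1" using e by (simp add: agn_def)
  have "fst cl i \<in> {0, 1}" "snd cl i j \<le> fst cl i" using cl by (auto simp: is_class_def split: prod.splits)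
  then have "fst cl i = 1" using x by auto
  moreover have "j < ncli I" using cl x by (cases cl) (force simp: is_class_def not_le[symmetric])
  ultimately show "e \<in> facs cl \<times> {..<ncli I}" using e by (simp add: facs_def)
qed

lemma fst_class: "is_class I cl \<Longrightarrow> fst cl i = of_bool (i \<in> facs cl)"
  by (cases cl) (auto simp: is_class_def facs_def)

lemma snd_class: "is_class I cl \<Longrightarrow> snd cl i j = of_bool ((i, j) \<in> agn cl)"
  by (cases cl) (auto simp: is_class_def agn_def)

lemma class_cost_eq:
  assumes "is_class I cl"
  shows "class_cost I cl = (\<Sum>i<nfac I. fst cl i * fcost I i)
    + (\<Sum>i<nfac I. \<Sum>j<ncli I. snd cl i j * ccost I i j)"
proof -
  have "(\<Sum>i\<in>facs cl. fcost I i) = (\<Sum>i<nfac I. fst cl i * fcost I i)"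
    using facs_subset[OF assms]
    by (intro sum.mono_neutral_cong_left) (auto simp: fst_class[OF assms])
  moreover have "(\<Sum>(i, j)\<in>agn cl. ccost I i j)
      = (\<Sum>(i, j)\<in>{..<nfac I} \<times> {..<ncli I}. snd cl i j * ccost I i j)"
    using agn_subset[OF assms] facs_subset[OF assms]
    by (intro sum.mono_neutral_cong_left) (auto simp: snd_class[OF assms])
  ultimately show ?thesis by (simp add: class_cost_def sum.cartesian_product)
qed

lemma class_cost_nonneg:
  assumes "wf_inst I" "is_class I cl"
  shows "0 \<le> class_cost I cl"
proof -
  from assms(1) obtain d where d:
    "\<forall>p\<in>sites I. d p p = 0"
    "\<forall>p\<in>sites I. \<forall>q\<in>sites I. d p q = d q p"
    "\<forall>p\<in>sites I. \<forall>q\<in>sites I. \<forall>r\<in>sites I. d p r \<le> d p q + d q r"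
    "\<forall>i<nfac I. \<forall>j<ncli I. ccost I i j = d (Inl i) (Inr j)"
    unfolding wf_inst_def metric_costs_def by blast
  have "0 \<le> ccost I i j" if "i < nfac I" "j < ncli I" for i j
  proof -
    have s: "Inl i \<in> sites I" "Inr j \<in> sites I" using that by (auto simp: sites_def)
    \<comment> \<open>The round trip from facility to client and back has length at least 0 and
      twice the connection cost.\<close>
    have "d (Inl i) (Inl i) \<le> d (Inl i) (Inr j) + d (Inr j) (Inl i)" using d(3) s by blast
    with d(1,2,4) s that show ?thesis by auto
  qed
  with assms show ?thesis
    unfolding class_cost_eq[OF assms(2)]
    by (intro add_nonneg_nonneg sum_nonneg)
      (auto simp: wf_inst_def fst_class[OF assms(2)] snd_class[OF assms(2)])
qed

section \<open>The relaxation formed by the integral solutions\<close>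

lemma int_solution_serves:
  assumes "s \<in> int_solutions k I" "j < ncli I"
  shows "\<exists>i. (i, j) \<in> agn s"
proof (rule ccontr)
  assume "\<not> ?thesis"
  then have "snd s i j = 0" for i
    using snd_class[OF int_solution_is_class[OF assms(1)]] by auto
  moreover have "(\<Sum>i<nfac I. snd s i j) = 1"
    using assms by (auto simp: int_solutions_def)
  ultimately show False by simp
qed

text \<open>Feasibility ignores costs, and the bound is the same for all facilities, so permuting
  the rows and columns of \<open>x\<close> merely reindexes the covering and load sums.\<close>

lemma relabel_int_solution:
  assumes p: "p permutes {..<nfac I}" and q: "q permutes {..<ncli I}"
    and s: "s \<in> int_solutions k I"
  shows "relabel p q s \<in> int_solutions k I"
proof -
  obtain y x where [simp]: "s = (y, x)" by (cases s)
  have cl: "is_class I (y, x)" and cov: "\<And>j. j < ncli I \<Longrightarrow> (\<Sum>i<nfac I. x i j) = 1"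
    and ld: "\<And>i. i < nfac I \<Longrightarrow> y i = 1 \<Longrightarrow> load_ok k (bnd I) (\<Sum>j<ncli I. x i j)"
    using s by (auto simp: int_solutions_def)
  have pn: "p i < nfac I \<longleftrightarrow> i < nfac I" for i using permutes_in_image[OF p, of i] by auto
  have qn: "q i < ncli I \<longleftrightarrow> i < ncli I" for i using permutes_in_image[OF q, of i] by auto
  have "is_class I (relabel p q s)"
    using cl pn qn by (auto simp: is_class_def relabel_def not_less[symmetric])
  moreover have "(\<Sum>i<nfac I. x (p i) (q j)) = 1" if "j < ncli I" for j
    using cov[of "q j"] that qn sum.permute[OF p, of "\<lambda>i. x i (q j)"] by (simp add: o_def)
  moreover have "load_ok k (bnd I) (\<Sum>j<ncli I. x (p i) (q j))"
    if "i < nfac I" "y (p i) = 1" for i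
    using ld[of "p i"] that pn sum.permute[OF q, of "\<lambda>j. x (p i) j"] by (simp add: o_def)
  ultimately show ?thesis by (simp add: int_solutions_def relabel_def)
qed

lemma sum_int_solutions_facs:
  "(\<Sum>cl | cl \<in> int_solutions k I \<and> i \<in> facs cl. w cl) = (\<Sum>s\<in>int_solutions k I. w s * fst s i)"
proof -
  have "(\<Sum>s\<in>int_solutions k I. w s * fst s i)
      = (\<Sum>s\<in>int_solutions k I. w s * of_bool (i \<in> facs s))"
    by (intro sum.cong refl) (simp add: fst_class[OF int_solution_is_class])
  also have "\<dots> = (\<Sum>cl | cl \<in> int_solutions k I \<and> i \<in> facs cl. w cl)"
    by (rule sum.mono_neutral_cong_right[OF finite_int_solutions]) auto
  finally show ?thesis by simp
qed

lemma sum_int_solutions_agn: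
  "(\<Sum>cl | cl \<in> int_solutions k I \<and> (i, j) \<in> agn cl. w cl)
    = (\<Sum>s\<in>int_solutions k I. w s * snd s i j)"
proof -
  have "(\<Sum>s\<in>int_solutions k I. w s * snd s i j)
      = (\<Sum>s\<in>int_solutions k I. w s * of_bool ((i, j) \<in> agn s))"
    by (intro sum.cong refl) (simp add: snd_class[OF int_solution_is_class])
  also have "\<dots> = (\<Sum>cl | cl \<in> int_solutions k I \<and> (i, j) \<in> agn cl. w cl)"
    by (rule sum.mono_neutral_cong_right[OF finite_int_solutions]) auto
  finally show ?thesis by simp
qed

text \<open>Every integral solution serves every client, so each covering constraint says that the
  total weight is 1, and there is at least one client. The packing constraints then bound partial
  sums of this total.\<close>

lemma lp_feasible_int_solutions_iff:
  assumes "wf_inst I"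
  shows "lp_feasible I (int_solutions k I) w \<longleftrightarrow>
    (\<forall>s\<in>int_solutions k I. 0 \<le> w s) \<and> (\<Sum>s\<in>int_solutions k I. w s) = 1"
proof -
  have cov: "{cl. cl \<in> int_solutions k I \<and> (\<exists>i. (i, j) \<in> agn cl)} = int_solutions k I"
    if "j < ncli I" for j
    using int_solution_serves that by blast
  have "(\<Sum>cl | cl \<in> int_solutions k I \<and> i \<in> facs cl. w cl) \<le> (\<Sum>s\<in>int_solutions k I. w s)"
    if "\<forall>s\<in>int_solutions k I. 0 \<le> w s" for i
    using that by (intro sum_mono2 finite_int_solutions) auto
  moreover have "0 < ncli I" using assms by (simp add: wf_inst_def)
  ultimately show ?thesis unfolding lp_feasible_def by (auto simp: cov)
qed

lemma lp_projection_int_solutions: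
  assumes "wf_inst I"
  shows "lp_projection I (int_solutions k I) = integral_polytope k I"
  unfolding lp_projection_def integral_polytope_def
  by (auto simp: proj_def lp_feasible_int_solutions_iff[OF assms] sum_int_solutions_facs
      sum_int_solutions_agn)

lemma int_solutions_subset_polytope: "int_solutions k I \<subseteq> integral_polytope k I"
proof
  fix s assume s: "s \<in> int_solutions k I"
  let ?u = "\<lambda>c. of_bool (c = s) :: real"
  have "(\<Sum>c\<in>int_solutions k I. ?u c * h c) = h s" for h
    using s finite_int_solutions[of k I] by (simp add: of_bool_def if_distrib[of "\<lambda>x. x * _"] sum.delta' cong: if_cong)
  from this[of "\<lambda>c. fst c _"] this[of "\<lambda>c. snd c _ _"] this[of "\<lambda>_. 1"]
  show "s \<in> integral_polytope k I"
    unfolding integral_polytope_def by (auto intro!: exI[of _ ?u] simp: prod_eq_iff)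
qed

lemma proper_int_solutions:
  assumes "wf_inst I"
  shows "proper k I (int_solutions k I)"
  using int_solutions_subset_polytope lp_projection_int_solutions[OF assms] relabel_int_solution
  by (auto simp: proper_def valid_def symmetric_def intro: int_solution_is_class)

lemma card_facs_le_max_open: "s \<in> int_solutions k I \<Longrightarrow> card (facs s) \<le> max_open k I"
  unfolding max_open_def using finite_int_solutions by (intro Max_ge) auto

text \<open>Keeps the denominator in \<open>complexity\<close> away from 0, where division would
  return 0.\<close>

lemma card_facs_pos:
  assumes "wf_inst I" "s \<in> int_solutions k I"
  shows "0 < card (facs s)"
proof -
  have "0 < ncli I" using assms by (simp add: wf_inst_def)
  then obtain i where "(i, 0) \<in> agn s" using int_solution_serves assms(2) by blast
  then have "i \<in> facs s" using agn_subset[OF int_solution_is_class[OF assms(2)]] by auto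
  moreover have "finite (facs s)"
    using facs_subset[OF int_solution_is_class[OF assms(2)]] finite_subset by blast
  ultimately show ?thesis by (auto simp: card_gt_0_iff)
qed

lemma complexity_int_solutions:
  assumes "I \<in> instances k"
  shows "complexity k I (int_solutions k I) = 1"
proof -
  have wf: "wf_inst I" and ne: "int_solutions k I \<noteq> {}" using assms by (auto simp: instances_def)
  have "max_open k I \<in> (\<lambda>s. card (facs s)) ` int_solutions k I"
    unfolding max_open_def using finite_int_solutions ne by (intro Max_in) auto
  then obtain s where s: "s \<in> int_solutions k I" "card (facs s) = max_open k I" by auto
  have pos: "0 < max_open k I" using card_facs_pos[OF wf s(1)] s(2) by simp
  show ?thesis unfolding complexity_def
  proof (rule cSup_eq_maximum)
    show "1 \<in> (\<lambda>cl. real (card (facs cl)) / real (max_open k I)) ` int_solutions k I"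
      using s pos by (intro image_eqI[of _ _ s]) auto
    show "x \<le> 1" if "x \<in> (\<lambda>cl. real (card (facs cl)) / real (max_open k I)) ` int_solutions k I" for x
      using that pos card_facs_le_max_open by (auto simp: divide_le_eq)
  qed
qed

section \<open>Block classes\<close>

text \<open>Under \<open>blocks\<close> this is a class of \<open>t\<close> facilities with exactly
  \<open>Q\<close> clients each. Describing it by enumerations rather than by sets reduces
  relabeling to the extension of a partial injection.\<close>

definition block_class :: "nat \<Rightarrow> nat \<Rightarrow> (nat \<Rightarrow> nat) \<Rightarrow> (nat \<Rightarrow> nat \<Rightarrow> nat) \<Rightarrow> vec" where
  "block_class t Q f g =
    (\<lambda>i. of_bool (\<exists>a<t. f a = i), \<lambda>i j. of_bool (\<exists>a<t. f a = i \<and> (\<exists>b<Q. g a b = j)))"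

definition blocks :: "inst \<Rightarrow> nat \<Rightarrow> nat \<Rightarrow> (nat \<Rightarrow> nat) \<Rightarrow> (nat \<Rightarrow> nat \<Rightarrow> nat) \<Rightarrow> bool" where
  "blocks I t Q f g \<longleftrightarrow> inj_on f {..<t} \<and> (\<forall>a<t. f a < nfac I) \<and>
    inj_on (\<lambda>(a, b). g a b) ({..<t} \<times> {..<Q}) \<and> (\<forall>a<t. \<forall>b<Q. g a b < ncli I)"

lemma facs_block_class: "facs (block_class t Q f g) = f ` {..<t}"
  by (auto simp: facs_def block_class_def)

lemma agn_block_class:
  "agn (block_class t Q f g) = (\<lambda>(a, b). (f a, g a b)) ` ({..<t} \<times> {..<Q})"
  by (auto simp: agn_def block_class_def image_iff)

text \<open>The complements of the two images in \<open>X\<close> have the same cardinality, so the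
  bijection between the images can be glued to one between the complements.\<close>

lemma permutes_extending:
  assumes X: "finite X" and g: "inj_on g A" "g ` A \<subseteq> X" and h: "inj_on h A" "h ` A \<subseteq> X"
  shows "\<exists>p. p permutes X \<and> (\<forall>a\<in>A. p (g a) = h a)"
proof -
  have "card (X - g ` A) = card (X - h ` A)"
    using X g h by (simp add: card_Diff_subset finite_subset card_image)
  then obtain r where r: "bij_betw r (X - g ` A) (X - h ` A)"
    using X by (meson finite_Diff finite_same_card_bij)
  let ?e = "\<lambda>x. h (the_inv_into A g x)"
  have e: "bij_betw ?e (g ` A) (h ` A)"
    using bij_betw_trans[OF bij_betw_the_inv_into[OF inj_on_imp_bij_betw[OF g(1)]]
        inj_on_imp_bij_betw[OF h(1)]] by (simp add: o_def)
  define p where "p x = (if x \<in> g ` A then ?e x else if x \<in> X then r x else x)" for x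
  have "bij_betw p (g ` A) (h ` A)"
    using e by (rule bij_betw_cong[THEN iffD1, rotated]) (simp add: p_def)
  moreover have "bij_betw p (X - g ` A) (X - h ` A)"
    using r by (rule bij_betw_cong[THEN iffD1, rotated]) (simp add: p_def)
  ultimately have "bij_betw p (g ` A \<union> (X - g ` A)) (h ` A \<union> (X - h ` A))"
    by (rule bij_betw_combine) auto
  then have "bij_betw p X X" using g(2) h(2) by (simp add: Un_absorb1)
  then have "p permutes X" using g(2) by (intro bij_imp_permutes) (auto simp: p_def)
  moreover have "p (g a) = h a" if "a \<in> A" for a
    using that g(1) by (simp add: p_def the_inv_into_f_f)
  ultimately show ?thesis by blast
qed

text \<open>All block classes with the same \<open>t\<close> and \<open>Q\<close> lie in one orbit
  under relabeling. As \<open>relabel\<close> composes on the inside, the permutations carry the new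
  enumerations to the old ones.\<close>

lemma block_class_mem_symmetric:
  assumes C: "symmetric I C" "block_class t Q f g \<in> C"
    and b: "blocks I t Q f g" "blocks I t Q f' g'"
  shows "block_class t Q f' g' \<in> C"
proof -
  have "\<exists>p. p permutes {..<nfac I} \<and> (\<forall>a\<in>{..<t}. p (f' a) = f a)"
    by (rule permutes_extending) (use b in \<open>auto simp: blocks_def\<close>)
  then obtain p where p: "p permutes {..<nfac I}" "\<And>a. a < t \<Longrightarrow> p (f' a) = f a"
    by (metis lessThan_iff)
  have "\<exists>q. q permutes {..<ncli I} \<and>
      (\<forall>y\<in>{..<t} \<times> {..<Q}. q ((\<lambda>(a, b). g' a b) y) = (\<lambda>(a, b). g a b) y)"
    by (rule permutes_extending) (use b in \<open>auto simp: blocks_def\<close>)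
  then obtain q where q: "q permutes {..<ncli I}" "\<And>a b. a < t \<Longrightarrow> b < Q \<Longrightarrow> q (g' a b) = g a b"
    by auto
  have pi: "f a = p i \<longleftrightarrow> f' a = i" if "a < t" for a i
    using p(2)[OF that] permutes_inj[OF p(1)] by (metis injD)
  have qi: "g a b = q j \<longleftrightarrow> g' a b = j" if "a < t" "b < Q" for a b j
    using q(2)[OF that] permutes_inj[OF q(1)] by (metis injD)
  have "relabel p q (block_class t Q f g) = block_class t Q f' g'"
    by (auto simp: relabel_def block_class_def fun_eq_iff pi qi cong: conj_cong)
  then show ?thesis using C p(1) q(1) unfolding symmetric_def by metis
qed

section \<open>Fractional solutions from weighted families of classes\<close>

lemma sum_of_bool_inj:
  assumes "finite A" "inj_on f A"
  shows "(\<Sum>a\<in>A. of_bool (f a = y)) = (of_bool (y \<in> f ` A) :: real)"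
proof -
  have "(\<Sum>a\<in>A. of_bool (f a = y)) = (\<Sum>x\<in>f ` A. of_bool (x = y) :: real)"
    by (simp add: sum.reindex[OF assms(2)])
  also have "\<dots> = of_bool (y \<in> f ` A)"
    using assms(1) by (simp add: of_bool_def sum.delta)
  finally show ?thesis .
qed

text \<open>The inner sum is the push-forward of the weights \<open>c\<close> along
  \<open>\<phi>\<close>. Collecting over fibres allows several indices to yield the same
  class.\<close>

lemma sum_mixture:
  fixes c G :: "_ \<Rightarrow> real"
  assumes "finite K" "finite C" "\<And>x. x \<in> K \<Longrightarrow> \<phi> x \<in> C"
  shows "(\<Sum>cl\<in>C. G cl * (\<Sum>x | x \<in> K \<and> \<phi> x = cl. c x)) = (\<Sum>x\<in>K. c x * G (\<phi> x))"
proof -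
  have "(\<Sum>cl\<in>C. G cl * (\<Sum>x | x \<in> K \<and> \<phi> x = cl. c x))
      = (\<Sum>cl\<in>C. \<Sum>x | x \<in> K \<and> \<phi> x = cl. c x * G (\<phi> x))"
    by (intro sum.cong) (auto simp: sum_distrib_left mult.commute)
  also have "\<dots> = (\<Sum>x\<in>K. c x * G (\<phi> x))"
    using assms by (intro sum.group) auto
  finally show ?thesis .
qed

lemma lp_opt_le_mixture:
  assumes K: "finite K" and C: "finite C" and \<phi>: "\<And>x. x \<in> K \<Longrightarrow> \<phi> x \<in> C"
    and c: "\<And>x. x \<in> K \<Longrightarrow> 0 \<le> c x"
    and cli: "\<And>j. j < ncli I \<Longrightarrow> (\<Sum>x\<in>K. c x * of_bool (\<exists>i. (i, j) \<in> agn (\<phi> x))) = 1"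
    and fac: "\<And>i. i < nfac I \<Longrightarrow> (\<Sum>x\<in>K. c x * of_bool (i \<in> facs (\<phi> x))) \<le> 1"
  shows "lp_opt I C \<le> ereal (\<Sum>x\<in>K. c x * class_cost I (\<phi> x))"
proof -
  define w where "w cl = (\<Sum>x | x \<in> K \<and> \<phi> x = cl. c x)" for cl
  have sel: "(\<Sum>cl | cl \<in> C \<and> P cl. w cl) = (\<Sum>x\<in>K. c x * of_bool (P (\<phi> x)))" for P
  proof -
    have "(\<Sum>cl | cl \<in> C \<and> P cl. w cl) = (\<Sum>cl\<in>C. of_bool (P cl) * w cl)"
      by (rule sum.mono_neutral_cong_left) (auto simp: C)
    then show ?thesis unfolding w_def using sum_mixture[OF K C \<phi>] by simp
  qed
  have "lp_feasible I C w"
    unfolding lp_feasible_def sel using cli fac c by (auto simp: w_def intro: sum_nonneg)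
  then have "lp_opt I C \<le> ereal (\<Sum>cl\<in>C. class_cost I cl * w cl)"
    unfolding lp_opt_def by (intro INF_lower) simp
  then show ?thesis unfolding w_def using sum_mixture[OF K C \<phi>, where G = "class_cost I"] by simp
qed

text \<open>For injective enumerations, whether a client or facility occurs equals how often it
  occurs. Counts, unlike existential statements, can be exchanged with the sum over \<open>K\<close>
  and evaluated by rotation.\<close>

lemma lp_opt_le_blocks:
  assumes K: "finite K" and C: "finite C"
    and mem: "\<And>f g. blocks I t Q f g \<Longrightarrow> block_class t Q f g \<in> C"
    and b: "\<And>x. x \<in> K \<Longrightarrow> blocks I t Q (f x) (g x)"
    and c: "\<And>x. x \<in> K \<Longrightarrow> 0 \<le> c x"
    and cli: "\<And>j. j < ncli I \<Longrightarrow> (\<Sum>x\<in>K. c x * (\<Sum>a<t. \<Sum>b<Q. of_bool (g x a b = j))) = 1"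
    and fac: "\<And>i. i < nfac I \<Longrightarrow> (\<Sum>x\<in>K. c x * (\<Sum>a<t. of_bool (f x a = i))) \<le> 1"
  shows "lp_opt I C \<le>
    ereal (\<Sum>x\<in>K. c x * ((\<Sum>a<t. fcost I (f x a)) + (\<Sum>a<t. \<Sum>b<Q. ccost I (f x a) (g x a b))))"
proof -
  let ?\<phi> = "\<lambda>x. block_class t Q (f x) (g x)"
  have cost: "class_cost I (?\<phi> x)
      = (\<Sum>a<t. fcost I (f x a)) + (\<Sum>a<t. \<Sum>b<Q. ccost I (f x a) (g x a b))" if "x \<in> K" for x
  proof -
    have 1: "inj_on (f x) {..<t}" and "inj_on (\<lambda>(a, b). g x a b) ({..<t} \<times> {..<Q})"
      using b[OF that] by (auto simp: blocks_def)
    then have 2: "inj_on (\<lambda>(a, b). (f x a, g x a b)) ({..<t} \<times> {..<Q})"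
      by (auto simp: inj_on_def)
    show ?thesis
      unfolding class_cost_def facs_block_class agn_block_class sum.reindex[OF 1] sum.reindex[OF 2]
      by (simp add: sum.cartesian_product o_def case_prod_unfold)
  qed
  have cli': "of_bool (\<exists>i. (i, j) \<in> agn (?\<phi> x)) = (\<Sum>a<t. \<Sum>b<Q. of_bool (g x a b = j) :: real)"
    if "x \<in> K" for x j
  proof -
    have 1: "inj_on (\<lambda>(a, b). g x a b) ({..<t} \<times> {..<Q})"
      using b[OF that] by (auto simp: blocks_def)
    have "(\<Sum>a<t. \<Sum>b<Q. of_bool (g x a b = j) :: real)
        = (\<Sum>y\<in>{..<t} \<times> {..<Q}. of_bool ((\<lambda>(a, b). g x a b) y = j))"
      unfolding sum.cartesian_product by (intro sum.cong) auto
    also have "\<dots> = of_bool (j \<in> (\<lambda>(a, b). g x a b) ` ({..<t} \<times> {..<Q}))"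
      by (rule sum_of_bool_inj[OF _ 1]) simp
    also have "\<dots> = of_bool (\<exists>i. (i, j) \<in> agn (?\<phi> x))"
      by (rule arg_cong[where f = of_bool]) (force simp: agn_block_class image_iff)
    finally show ?thesis by simp
  qed
  have fac': "of_bool (i \<in> facs (?\<phi> x)) = (\<Sum>a<t. of_bool (f x a = i) :: real)"
    if "x \<in> K" for x i
    unfolding facs_block_class
    by (rule sum_of_bool_inj[symmetric]) (use b[OF that] in \<open>auto simp: blocks_def\<close>)
  have "lp_opt I C \<le> ereal (\<Sum>x\<in>K. c x * class_cost I (?\<phi> x))"
    using cli fac b by (intro lp_opt_le_mixture[OF K C _ c]) (auto simp: mem cli' fac' cong: sum.cong)
  then show ?thesis by (simp add: cost cong: sum.cong)
qed

section \<open>Block classes forced by validity and symmetry\<close>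

text \<open>Outside \<open>s\<close> the total weight is 0, so a class of positive weight stays
  inside \<open>s\<close>. An assignment of \<open>s\<close> and its facility both carry weight 1,
  so such a class cannot open the facility without making the assignment.\<close>

lemma decomposition_class:
  assumes C: "proper k I C" and s: "s \<in> int_solutions k I"
    and small: "\<And>cl. cl \<in> C \<Longrightarrow> card (facs cl) < card (facs s)"
    and z: "z \<in> facs s"
  shows "\<exists>cl\<in>C. facs cl \<noteq> {} \<and> facs cl \<subseteq> facs s - {z} \<and> agn cl = {e \<in> agn s. fst e \<in> facs cl}"
proof -
  have fin: "finite C" using C by (rule finite_proper)
  have scl: "is_class I s" using s by (rule int_solution_is_class)
  have "s \<in> lp_projection I C" using C s by (auto simp: proper_def valid_def)
  then obtain w where w: "lp_feasible I C w" and sw: "s = proj C w"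
    by (auto simp: lp_projection_def)
  have nn: "0 \<le> w cl" if "cl \<in> C" for cl using w that by (auto simp: lp_feasible_def)
  have y: "(\<Sum>cl | cl \<in> C \<and> i \<in> facs cl. w cl) = of_bool (i \<in> facs s)" for i
    using fst_class[OF scl, of i] by (subst (asm) sw) (simp add: proj_def)
  have x: "(\<Sum>cl | cl \<in> C \<and> (i, j) \<in> agn cl. w cl) = of_bool ((i, j) \<in> agn s)" for i j
    using snd_class[OF scl, of i j] by (subst (asm) sw) (simp add: proj_def)
  \<comment> \<open>For a class of positive weight this makes the sum over \<open>Y\<close> strictly
    larger; the contradictions below all compare two sums that are known to be equal.\<close>
  have strict: "sum w X + w cl \<le> sum w Y" if "X \<subseteq> Y" "Y \<subseteq> C" "cl \<in> Y - X" for X Y cl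
  proof -
    have f: "finite Y" "finite X" using that fin by (meson finite_subset)+
    have "sum w (insert cl X) \<le> sum w Y"
      using that f by (intro sum_mono2) (auto intro: nn)
    then show ?thesis using that f by simp
  qed
  have up: "i \<in> facs s" if "cl \<in> C" "0 < w cl" "i \<in> facs cl" for cl i
    using strict[of "{}" "{cl \<in> C. i \<in> facs cl}" cl] that y[of i] by (cases "i \<in> facs s") auto
  have restr: "agn cl = {e \<in> agn s. fst e \<in> facs cl}" if "cl \<in> C" "0 < w cl" for cl
  proof -
    have sub: "agn c \<subseteq> facs c \<times> {..<ncli I}" if "c \<in> C" for c
      using C that by (intro agn_subset) (auto simp: proper_def)
    have "(i, j) \<in> agn s \<and> i \<in> facs cl" if "(i, j) \<in> agn cl" for i j
      using strict[of "{}" "{c \<in> C. (i, j) \<in> agn c}" cl] that x[of i j] \<open>cl \<in> C\<close> \<open>0 < w cl\<close>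
        sub[OF \<open>cl \<in> C\<close>] by (cases "(i, j) \<in> agn s") auto
    moreover have "(i, j) \<in> agn cl" if "(i, j) \<in> agn s" "i \<in> facs cl" for i j
    proof (rule ccontr)
      assume "(i, j) \<notin> agn cl"
      \<comment> \<open>Both sums are 1, while \<open>cl\<close> contributes to the right one
        only.\<close>
      then have "sum w {c \<in> C. (i, j) \<in> agn c} + w cl \<le> sum w {c \<in> C. i \<in> facs c}"
        using sub that \<open>cl \<in> C\<close> by (intro strict) auto
      then show False using x[of i j] y[of i] that up[of cl i] \<open>cl \<in> C\<close> \<open>0 < w cl\<close> by auto
    qed
    ultimately have "(i, j) \<in> agn cl \<longleftrightarrow> (i, j) \<in> agn s \<and> i \<in> facs cl" for i j by blast
    then show ?thesis by auto
  qed
  have "sum w {c \<in> C. z \<in> facs c} = 1" using y[of z] z by simp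
  then obtain c where c: "c \<in> C" "z \<in> facs c" "0 < w c"
    using nn by (metis (mono_tags, lifting) mem_Collect_eq order_less_le sum.neutral zero_neq_one)
  have "facs c \<subseteq> facs s" using c up by blast
  with small[OF c(1)] have "\<exists>i\<in>facs s. i \<notin> facs c"
    by (metis less_irrefl subsetI subset_antisym)
  then obtain i where i: "i \<in> facs s" "i \<notin> facs c" by blast
  \<comment> \<open>The classes using \<open>i\<close> carry as much weight as those using \<open>z\<close>, and \<open>c\<close> uses only \<open>z\<close>.\<close>
  have "\<exists>cl\<in>C. 0 < w cl \<and> i \<in> facs cl \<and> z \<notin> facs cl"
  proof (rule ccontr)
    assume "\<not> ?thesis"
    then have "sum w {cl \<in> C. 0 < w cl \<and> i \<in> facs cl} + w c \<le> sum w {cl \<in> C. z \<in> facs cl}"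
      using c i by (intro strict) auto
    moreover have "sum w {cl \<in> C. 0 < w cl \<and> i \<in> facs cl} = sum w {cl \<in> C. i \<in> facs cl}"
      using fin nn by (intro sum.mono_neutral_left) (auto simp: order_less_le)
    ultimately show False using y[of i] y[of z] i z c by simp
  qed
  then show ?thesis using restr up by blast
qed

text \<open>Clients are cut into consecutive blocks of length \<open>Q\<close>; \<open>min\<close>
  sends everything from client \<open>z * Q\<close> on to facility \<open>z\<close>, the exceptional
  one. It receives 1 client in the capacitated instances and \<open>2 * q + 1\<close> in the
  lower-bounded ones.\<close>

definition block_solution :: "nat \<Rightarrow> nat \<Rightarrow> nat \<Rightarrow> vec" where
  "block_solution m z Q =
    (\<lambda>i. of_bool (i \<le> z), \<lambda>i j. of_bool (j < m \<and> i = min (j div Q) z))"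

lemma facs_block_solution: "facs (block_solution m z Q) = {..z}"
  by (auto simp: facs_def block_solution_def)

lemma agn_block_solution:
  "agn (block_solution m z Q) = {(i, j). j < m \<and> i = min (j div Q) z}"
  by (auto simp: agn_def block_solution_def)

lemma block_solution_mem:
  assumes "z < nfac I"
    and "\<And>i. i \<le> z \<Longrightarrow> load_ok k (bnd I) (real (card {j. j < ncli I \<and> i = min (j div Q) z}))"
  shows "block_solution (ncli I) z Q \<in> int_solutions k I"
proof -
  have "(\<Sum>j<ncli I. of_bool (j < ncli I \<and> i = min (j div Q) z))
      = real (card {j. j < ncli I \<and> i = min (j div Q) z})" for i
  proof -
    have "{..<ncli I} \<inter> {j. i = min (j div Q) z} = {j. j < ncli I \<and> i = min (j div Q) z}"
      by auto
    then show ?thesis by simp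
  qed
  moreover have "(\<Sum>i<nfac I. of_bool (j < ncli I \<and> i = min (j div Q) z)) = (1::real)"
    if "j < ncli I" for j
    using that assms(1) by (simp add: of_bool_def sum.delta)
  ultimately show ?thesis
    using assms by (auto simp: int_solutions_def block_solution_def is_class_def simp del: of_bool_conj)
qed

text \<open>A class that misses facility \<open>z\<close> is a restriction to facilities with full
  blocks of exactly \<open>Q\<close> clients, hence a block class; symmetry supplies all others of
  the same shape.\<close>

lemma block_classes_mem:
  assumes C: "proper k I C" and s: "block_solution (ncli I) z Q \<in> int_solutions k I"
    and M: "max_open k I = z + 1" and cpl: "complexity k I C < 1"
    and m: "z * Q \<le> ncli I" and Q: "0 < Q"
  shows "\<exists>t. 1 \<le> t \<and> t \<le> z \<and> (\<forall>f g. blocks I t Q f g \<longrightarrow> block_class t Q f g \<in> C)"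
proof -
  let ?s = "block_solution (ncli I) z Q"
  have fin: "finite C" using C by (rule finite_proper)
  have zn: "z < nfac I"
    using facs_subset[OF int_solution_is_class[OF s]] by (auto simp: facs_block_solution)
  have "card (facs cl) < card (facs ?s)" if "cl \<in> C" for cl
  proof -
    have "real (card (facs cl)) / real (max_open k I) \<le> complexity k I C"
      unfolding complexity_def using fin that by (intro cSUP_upper) auto
    with cpl have "real (card (facs cl)) / real (max_open k I) < 1" by linarith
    then show ?thesis using M by (simp add: facs_block_solution divide_less_eq)
  qed
  from decomposition_class[OF C s this, of z] obtain cl where
    cl: "cl \<in> C" and ne: "facs cl \<noteq> {}" and sub: "facs cl \<subseteq> {..z} - {z}"
    and agn: "agn cl = {e \<in> agn ?s. fst e \<in> facs cl}"
    by (auto simp: facs_block_solution)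
  have sub': "facs cl \<subseteq> {..<z}" using sub by auto
  then have finS: "finite (facs cl)" by (rule finite_subset) simp
  define t where "t = card (facs cl)"
  obtain f where "bij_betw f {0..<t} (facs cl)"
    using ex_bij_betw_nat_finite[OF finS] by (auto simp: t_def)
  then have f: "inj_on f {..<t}" "f ` {..<t} = facs cl"
    by (auto simp: bij_betw_def atLeast0LessThan)
  define g where "g a b = f a * Q + b" for a b
  have fz: "f a < z" if "a < t" for a using f(2) sub' that by blast
  have gm: "g a b < z * Q" if "a < t" "b < Q" for a b
  proof -
    have "Suc (f a) * Q \<le> z * Q" using fz[OF that(1)] by (intro mult_le_mono1) simp
    then show ?thesis using that by (simp add: g_def)
  qed
  have "blocks I t Q f g"
    unfolding blocks_def
  proof (intro conjI allI impI)
    show "inj_on (\<lambda>(a, b). g a b) ({..<t} \<times> {..<Q})"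
    proof (rule inj_onI, clarsimp)
      fix a b a' b' assume *: "a < t" "b < Q" "a' < t" "b' < Q" "g a b = g a' b'"
      then have "(f a * Q + b) div Q = (f a' * Q + b') div Q"
        "(f a * Q + b) mod Q = (f a' * Q + b') mod Q" by (simp_all add: g_def)
      then have "f a = f a'" "b = b'" using * by auto
      then show "a = a' \<and> b = b'" using f(1) * by (auto simp: inj_on_def)
    qed
    show "f a < nfac I" if "a < t" for a using fz[OF that] zn by simp
    show "g a b < ncli I" if "a < t" "b < Q" for a b using gm[OF that] m by simp
  qed (rule f(1))
  moreover have "cl = block_class t Q f g"
  proof (rule prod_eqI)
    have icl: "is_class I cl" using C cl by (auto simp: proper_def)
    show "fst cl = fst (block_class t Q f g)"
      unfolding fst_class[OF icl, abs_def] f(2)[symmetric]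
      by (auto simp: fun_eq_iff block_class_def fst_class[OF icl] f(2)[symmetric] image_iff)
    have "(i, j) \<in> agn cl \<longleftrightarrow> (\<exists>a<t. f a = i \<and> (\<exists>b<Q. g a b = j))" for i j
    proof
      assume "(i, j) \<in> agn cl"
      then have *: "i \<in> facs cl" "i = min (j div Q) z"
        unfolding agn agn_block_solution by auto
      then have "i = j div Q" using sub' by auto
      moreover obtain a where "a < t" "f a = i" using *(1) f(2) by (metis imageE lessThan_iff)
      ultimately show "\<exists>a<t. f a = i \<and> (\<exists>b<Q. g a b = j)"
        using Q by (intro exI[of _ a] conjI exI[of _ "j mod Q"]) (auto simp: g_def)
    next
      assume "\<exists>a<t. f a = i \<and> (\<exists>b<Q. g a b = j)"
      then obtain a b where *: "a < t" "f a = i" "b < Q" "g a b = j" by blast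
      then have "j div Q = i" "j < ncli I" "i \<in> facs cl" "i < z"
        using gm[of a b] m f(2) fz[of a] by (auto simp: g_def)
      then show "(i, j) \<in> agn cl" unfolding agn agn_block_solution by auto
    qed
    then show "snd cl = snd (block_class t Q f g)"
      by (simp add: fun_eq_iff block_class_def snd_class[OF icl])
  qed
  moreover have "symmetric I C" using C by (simp add: proper_def)
  ultimately have "block_class t Q f' g' \<in> C" if "blocks I t Q f' g'" for f' g'
    using block_class_mem_symmetric cl that by metis
  moreover have "1 \<le> t" using ne finS by (simp add: t_def Suc_le_eq card_gt_0_iff)
  moreover have "t \<le> z" using card_mono[OF _ sub'] by (simp add: t_def)
  ultimately show ?thesis by blast
qed

section \<open>Bounding the integrality gap\<close>

lemma int_opt_ge:
  assumes "\<And>s. s \<in> int_solutions k I \<Longrightarrow> A \<le> class_cost I s"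
  shows "ereal A \<le> int_opt k I"
  unfolding int_opt_def using assms by (intro INF_greatest) simp

lemma lp_opt_nonneg:
  assumes "wf_inst I" "proper k I C"
  shows "0 \<le> lp_opt I C"
  unfolding lp_opt_def
proof (rule INF_greatest)
  fix w assume "w \<in> {w. lp_feasible I C w}"
  then have "0 \<le> class_cost I cl * w cl" if "cl \<in> C" for cl
    using that assms class_cost_nonneg[OF assms(1), of cl]
    by (auto simp: lp_feasible_def proper_def)
  then show "0 \<le> ereal (\<Sum>cl\<in>C. class_cost I cl * w cl)" by (simp add: sum_nonneg)
qed

lemma gap_ratio_ge:
  assumes "wf_inst I" "proper k I C"
    and "ereal A \<le> int_opt k I" "lp_opt I C \<le> ereal B" "0 < A" "0 < B"
  shows "ereal (A / B) \<le> int_opt k I / lp_opt I C"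
proof -
  have nn: "0 \<le> lp_opt I C" using assms(1,2) by (rule lp_opt_nonneg)
  with assms(4) obtain l where l: "lp_opt I C = ereal l" by (cases "lp_opt I C") auto
  have pos: "0 < int_opt k I" using assms(3,5) by (metis ereal_less(2) less_le_trans)
  show ?thesis
  proof (cases "l = 0")
    \<comment> \<open>A fractional optimum of 0 makes the ratio infinite, as the integral optimum is
      positive.\<close>
    case True
    then have "int_opt k I / lp_opt I C = \<infinity>"
      using pos l by (cases "int_opt k I") (auto simp: divide_ereal_def)
    then show ?thesis by simp
  next
    case False
    then have "0 < l" "l \<le> B" using nn l assms(4) by auto
    then have "ereal (A / B) \<le> ereal A / ereal l"
      using assms(5) by (simp add: frac_le)
    also have "\<dots> \<le> int_opt k I / ereal l"
      using assms(3) \<open>0 < l\<close> by (intro ereal_divide_right_mono) auto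
    finally show ?thesis using l by simp
  qed
qed

lemma integrality_gap_infinite:
  assumes R: "proper_relaxation k R"
    and ex: "\<And>c::nat. \<exists>I A B. I \<in> instances k \<and> ereal A \<le> int_opt k I \<and> lp_opt I (R I) \<le> ereal B
      \<and> 0 < A \<and> 0 < B \<and> real c \<le> A / B"
  shows "integrality_gap k R = \<infinity>"
  unfolding integrality_gap_def
proof (rule SUP_PInfty)
  fix c :: nat
  obtain I A B where I: "I \<in> instances k" "ereal A \<le> int_opt k I" "lp_opt I (R I) \<le> ereal B"
    "0 < A" "0 < B" "real c \<le> A / B" using ex by blast
  have "wf_inst I" "proper k I (R I)"
    using R I(1) by (auto simp: proper_relaxation_def instances_def)
  from gap_ratio_ge[OF this I(2-5)] I(6) have "ereal (real c) \<le> int_opt k I / lp_opt I (R I)"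
    by (meson ereal_less_eq(3) order_trans)
  with I(1) show "\<exists>I\<in>instances k. ereal (real c) \<le> int_opt k I / lp_opt I (R I)" by blast
qed

section \<open>Counting bounds on the number of open facilities\<close>

lemma max_open_eqI:
  assumes "s \<in> int_solutions k I" "card (facs s) = n"
    and "\<And>s. s \<in> int_solutions k I \<Longrightarrow> card (facs s) \<le> n"
  shows "max_open k I = n"
  unfolding max_open_def using assms finite_int_solutions by (intro Max_eqI) auto

text \<open>Double counting of the assignments, by facility and by client; closed facilities have
  load 0.\<close>

lemma sum_loads:
  assumes s: "s \<in> int_solutions k I"
  shows "(\<Sum>i\<in>facs s. \<Sum>j<ncli I. snd s i j) = real (ncli I)"
proof -
  have cl: "is_class I s" using s by (rule int_solution_is_class)
  have "(\<Sum>i\<in>facs s. \<Sum>j<ncli I. snd s i j) = (\<Sum>i<nfac I. \<Sum>j<ncli I. snd s i j)"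
    using facs_subset[OF cl] agn_subset[OF cl]
    by (intro sum.mono_neutral_left) (auto simp: snd_class[OF cl] intro!: sum.neutral)
  also have "\<dots> = (\<Sum>j<ncli I. \<Sum>i<nfac I. snd s i j)" by (rule sum.swap)
  also have "\<dots> = (\<Sum>j<ncli I. 1)"
    using s by (intro sum.cong) (auto simp: int_solutions_def)
  finally show ?thesis by simp
qed

lemma load_int_solution:
  assumes "s \<in> int_solutions k I" "i \<in> facs s"
  shows "load_ok k (bnd I) (\<Sum>j<ncli I. snd s i j)"
  using assms facs_subset[OF int_solution_is_class[OF assms(1)]]
  by (auto simp: int_solutions_def facs_def)

lemma clients_le_capacity:
  assumes "s \<in> int_solutions CFL I"
  shows "ncli I \<le> card (facs s) * bnd I"
proof -
  have "real (ncli I) \<le> real (card (facs s) * bnd I)"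
    unfolding sum_loads[OF assms, symmetric] of_nat_mult
    using load_int_solution[OF assms] by (intro sum_bounded_above) (simp add: load_ok_def)
  then show ?thesis by linarith
qed

lemma lower_bounds_le_clients:
  assumes "s \<in> int_solutions LBFL I"
  shows "card (facs s) * bnd I \<le> ncli I"
proof -
  have "real (card (facs s) * bnd I) \<le> real (ncli I)"
    unfolding sum_loads[OF assms, symmetric] of_nat_mult
    using load_int_solution[OF assms] by (intro sum_bounded_below) (simp add: load_ok_def)
  then show ?thesis by linarith
qed

section \<open>Blocks of consecutive numbers and cyclic rotation\<close>

lemma div_eq_block: "0 < (Q::nat) \<Longrightarrow> {j. j div Q = i} = {i * Q..<i * Q + Q}"
proof (intro set_eqI iffI)
  fix j assume Q: "0 < Q" and "j \<in> {j. j div Q = i}"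
  then show "j \<in> {i * Q..<i * Q + Q}"
    using dividend_less_times_div[OF Q, of j] by (auto simp: ac_simps)
qed (auto intro: div_nat_eqI simp: ac_simps)

lemma add_mod_inj:
  assumes "(u + c) mod m = (v + c) mod m" "u < m" "v < (m::nat)"
  shows "u = v"
proof -
  have *: "a \<le> b" if "(a + c) mod m = (b + c) mod m" "a < m" for a b
  proof (rule ccontr)
    assume "\<not> a \<le> b"
    then have "m dvd a - b"
      using mod_eq_dvd_iff_nat[of "b + c" "a + c" m] that(1) by simp
    then show False using dvd_imp_le[of m "a - b"] that(2) \<open>\<not> a \<le> b\<close> by simp
  qed
  show ?thesis using *[of u v] *[of v u] assms by simp
qed

text \<open>Rotation permutes the residues modulo \<open>m\<close>. This is why averaging over all
  starting points covers every client to the same extent.\<close>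

lemma sum_rotate: "(\<Sum>u<m. h ((u + c) mod m)) = (\<Sum>u<(m::nat). h u)"
proof (cases "m = 0")
  case False
  have inj: "inj_on (\<lambda>u. (u + c) mod m) {..<m}"
    by (auto intro!: inj_onI dest: add_mod_inj)
  moreover have "(\<lambda>u. (u + c) mod m) ` {..<m} = {..<m}"
    using False by (intro endo_inj_surj inj) auto
  ultimately have "bij_betw (\<lambda>u. (u + c) mod m) {..<m} {..<m}" by (simp add: bij_betw_def)
  then show ?thesis by (rule sum.reindex_bij_betw)
qed simp

lemma sum_rotate_delta:
  "j < m \<Longrightarrow> (\<Sum>u<(m::nat). of_bool ((u + c) mod m = j)) = (1::real)"
  using sum_rotate[where h = "\<lambda>u. of_bool (u = j) :: real"]
  by (simp add: of_bool_def sum.delta del: sum_of_bool_eq)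

section \<open>The capacitated instances\<close>

text \<open>There is one client more than \<open>z\<close> facilities can serve, so all
  \<open>z + 1\<close> facilities must open, including the costly one.\<close>

definition cfl_inst :: "nat \<Rightarrow> nat \<Rightarrow> inst" where
  "cfl_inst z Q = \<lparr>nfac = z + 1, ncli = z * Q + 1, bnd = Q,
    fcost = (\<lambda>i. of_bool (i = z)), ccost = (\<lambda>_ _. 0)\<rparr>"

lemma cfl_inst_sel [simp]:
  "nfac (cfl_inst z Q) = z + 1" "ncli (cfl_inst z Q) = z * Q + 1" "bnd (cfl_inst z Q) = Q"
  "fcost (cfl_inst z Q) = (\<lambda>i. of_bool (i = z))" "ccost (cfl_inst z Q) = (\<lambda>_ _. 0)"
  by (simp_all add: cfl_inst_def)

lemma wf_cfl_inst: "0 < Q \<Longrightarrow> wf_inst (cfl_inst z Q)"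
  by (auto simp: wf_inst_def metric_costs_def intro!: exI[of _ "\<lambda>_ _. 0"])

lemma block_solution_cfl:
  assumes "0 < Q"
  shows "block_solution (ncli (cfl_inst z Q)) z Q \<in> int_solutions CFL (cfl_inst z Q)"
proof (rule block_solution_mem)
  fix i assume "i \<le> z"
  show "load_ok CFL (bnd (cfl_inst z Q))
    (real (card {j. j < ncli (cfl_inst z Q) \<and> i = min (j div Q) z}))"
  proof (cases "i = z")
    case True
    have "j = z * Q" if "j < z * Q + 1" "i = min (j div Q) z" for j
    proof -
      have "z \<le> j div Q" using that(2) True by simp
      then have "z * Q \<le> j div Q * Q" by (rule mult_le_mono1)
      also have "\<dots> \<le> j" by (rule div_times_less_eq_dividend)
      finally show ?thesis using that(1) by simp
    qed
    then have "{j. j < z * Q + 1 \<and> i = min (j div Q) z} \<subseteq> {z * Q}" by blast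
    from card_mono[OF _ this] have "card {j. j < z * Q + 1 \<and> i = min (j div Q) z} \<le> 1" by simp
    then show ?thesis using assms by (simp add: load_ok_def)
  next
    case False
    then have "{j. j < z * Q + 1 \<and> i = min (j div Q) z} \<subseteq> {i * Q..<i * Q + Q}"
      unfolding div_eq_block[OF assms, symmetric] using \<open>i \<le> z\<close> by (auto simp: min_def split: if_splits)
    from card_mono[OF _ this] have "card {j. j < z * Q + 1 \<and> i = min (j div Q) z} \<le> Q" by simp
    then show ?thesis by (simp add: load_ok_def)
  qed
qed simp

lemma max_open_cfl:
  assumes "0 < Q"
  shows "max_open CFL (cfl_inst z Q) = z + 1"
proof (rule max_open_eqI[OF block_solution_cfl[OF assms]])
  fix s assume "s \<in> int_solutions CFL (cfl_inst z Q)"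
  from card_mono[OF _ facs_subset[OF int_solution_is_class[OF this]]]
  show "card (facs s) \<le> z + 1" by simp
qed (simp add: facs_block_solution)

lemma class_cost_cfl_ge:
  assumes s: "s \<in> int_solutions CFL (cfl_inst z Q)"
  shows "1 \<le> class_cost (cfl_inst z Q) s"
proof -
  have sub: "facs s \<subseteq> {..z}"
    using facs_subset[OF int_solution_is_class[OF s]] by auto
  have "z \<in> facs s"
  proof (rule ccontr)
    assume "z \<notin> facs s"
    with sub have "facs s \<subseteq> {..<z}" using nat_less_le by auto
    then have "card (facs s) \<le> z" using card_mono[of "{..<z}"] by simp
    then have "card (facs s) * Q \<le> z * Q" by (rule mult_le_mono1)
    with clients_le_capacity[OF s] show False by simp
  qed
  moreover have "finite (facs s)" using sub by (rule finite_subset) simp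
  ultimately show ?thesis
    by (simp add: class_cost_def of_bool_def sum.delta' case_prod_unfold)
qed

text \<open>
  Class \<open>u\<close> places \<open>t\<close> consecutive windows of length \<open>Q\<close> on the cycle of the \<open>m = z * Q + 1\<close>
  clients, starting at \<open>u\<close>; the window starting at client \<open>v\<close> is served by facility \<open>v div Q\<close>.
  Facility \<open>z\<close>, the only one with a cost, owns a single starting point.
\<close>

lemma lp_opt_cfl_le:
  assumes Q: "0 < Q" and t: "1 \<le> t" "t \<le> z" and fin: "finite C"
    and mem: "\<And>f g. blocks (cfl_inst z Q) t Q f g \<Longrightarrow> block_class t Q f g \<in> C"
  shows "lp_opt (cfl_inst z Q) C \<le> ereal (1 / Q)"
proof -
  define m where "m = z * Q + 1"
  define f where "f u a = ((u + a * Q) mod m) div Q" for u a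
  define g where "g u a b = (u + (a * Q + b)) mod m" for u a b
  \<comment> \<open>For each of the \<open>t * Q\<close> pairs \<open>(a, b)\<close> exactly one
    \<open>u\<close> reaches a given client, so this weight covers it exactly once.\<close>
  define c where "c = 1 / (real t * real Q)"
  have m: "0 < m" by (simp add: m_def)
  have blk: "blocks (cfl_inst z Q) t Q (f u) (g u)" for u
    unfolding blocks_def
  proof (intro conjI allI impI)
    \<comment> \<open>Two windows of one class start \<open>d * Q\<close> apart. Without wrapping,
      the quotient by \<open>Q\<close> grows by \<open>d\<close>; with wrapping, the new start lies
      at least \<open>Q\<close> below the old one, because
      \<open>d * Q + Q <= z * Q < m\<close>.\<close>
    have ne: "f u a \<noteq> f u (a + d)" if "0 < d" "a + d < t" for a d
    proof -
      let ?v = "(u + a * Q) mod m"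
      have v: "?v < m" using m by simp
      have e: "(u + (a + d) * Q) mod m = (?v + d * Q) mod m"
        by (simp add: mod_simps algebra_simps)
      show ?thesis
      proof (cases "?v + d * Q < m")
        case True
        then have "f u (a + d) = f u a + d" using Q by (simp add: f_def e)
        then show ?thesis using that by simp
      next
        case False
        have dz: "d * Q + Q \<le> z * Q"
          using that t mult_le_mono1[of "d + 1" z Q] by simp
        then have "d * Q < m" by (simp add: m_def)
        then have "?v + d * Q - m < m" using v by linarith
        then have "(?v + d * Q) mod m = ?v + d * Q - m"
          using False le_mod_geq[of m "?v + d * Q"] mod_less by (metis not_le)
        then have "(?v + d * Q) mod m + Q \<le> ?v" using dz False by (simp add: m_def)
        then have "((?v + d * Q) mod m + Q) div Q \<le> ?v div Q" by (rule div_le_mono)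
        then show ?thesis using Q by (simp add: f_def e)
      qed
    qed
    show "inj_on (f u) {..<t}"
    proof (rule inj_onI, clarsimp)
      fix a a' assume "a < t" "a' < t" "f u a = f u a'"
      then show "a = a'"
        using ne[of "a' - a" a] ne[of "a - a'" a'] by (cases a a' rule: linorder_cases) auto
    qed
    show "f u a < nfac (cfl_inst z Q)" for a
    proof -
      have "(u + a * Q) mod m < m" using m by simp
      then have "(u + a * Q) mod m \<le> z * Q" by (simp add: m_def)
      then have "f u a \<le> (z * Q) div Q" unfolding f_def by (rule div_le_mono)
      then show ?thesis using Q by simp
    qed
    show "g u a b < ncli (cfl_inst z Q)" for a b
      using m by (simp add: g_def m_def)
    show "inj_on (\<lambda>(a, b). g u a b) ({..<t} \<times> {..<Q})"
    proof (rule inj_onI, clarsimp)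
      fix a b a' b' assume *: "a < t" "b < Q" "a' < t" "b' < Q" "g u a b = g u a' b'"
      \<comment> \<open>As \<open>t <= z\<close>, the windows together are shorter than the cycle
        and cannot overlap.\<close>
      have small: "a * Q + b < m" if "a < t" "b < Q" for a b
        using that t mult_le_mono1[of "a + 1" z Q] by (simp add: m_def)
      have eq: "a * Q + b = a' * Q + b'"
        by (rule add_mod_inj[where c = u and m = m])
          (use *(5) small[OF *(1,2)] small[OF *(3,4)] in \<open>auto simp: g_def add.commute\<close>)
      then have "(a * Q + b) div Q = (a' * Q + b') div Q" "(a * Q + b) mod Q = (a' * Q + b') mod Q"
        by simp_all
      then show "a = a' \<and> b = b'" using * by auto
    qed
  qed
  have ctQ: "c * (real t * real Q) = 1" using Q t by (simp add: c_def)
  have "lp_opt (cfl_inst z Q) C \<le> ereal (\<Sum>u<m. c * ((\<Sum>a<t. fcost (cfl_inst z Q) (f u a))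
      + (\<Sum>a<t. \<Sum>b<Q. ccost (cfl_inst z Q) (f u a) (g u a b))))"
  proof (rule lp_opt_le_blocks[OF _ fin mem blk])
    fix j assume "j < ncli (cfl_inst z Q)"
    then have j: "j < m" by (simp add: m_def)
    have "(\<Sum>u<m. c * (\<Sum>a<t. \<Sum>b<Q. of_bool (g u a b = j)))
        = c * (\<Sum>a<t. \<Sum>b<Q. \<Sum>u<m. of_bool (g u a b = j))"
      unfolding sum_distrib_left[symmetric]
      by (subst sum.swap, rule arg_cong[where f = "(*) c"], rule sum.cong[OF refl], rule sum.swap)
    also have "\<dots> = c * (\<Sum>a<t. \<Sum>b<Q. 1)"
      unfolding g_def sum_rotate_delta[OF j] ..
    finally show "(\<Sum>u<m. c * (\<Sum>a<t. \<Sum>b<Q. of_bool (g u a b = j))) = 1"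
      using ctQ by simp
  next
    fix i
    have "(\<Sum>u<m. c * (\<Sum>a<t. of_bool (f u a = i))) = c * (\<Sum>a<t. \<Sum>u<m. of_bool (f u a = i))"
      unfolding sum_distrib_left[symmetric] by (subst sum.swap) rule
    also have "\<dots> = c * (\<Sum>a<t. \<Sum>v<m. of_bool (v div Q = i))"
      unfolding f_def using sum_rotate[where h = "\<lambda>v. of_bool (v div Q = i) :: real"]
      by (simp del: sum_of_bool_eq)
    \<comment> \<open>A facility owns at most \<open>Q\<close> starting points, and each of the
      \<open>t\<close> windows meets each of them once.\<close>
    also have "\<dots> \<le> c * (\<Sum>a<t. real Q)"
    proof (intro mult_left_mono sum_mono)
      have "card ({..<m} \<inter> {v. v div Q = i}) \<le> card {v. v div Q = i}"
        unfolding div_eq_block[OF Q] by (intro card_mono) auto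
      then show "(\<Sum>v<m. of_bool (v div Q = i)) \<le> real Q"
        by (simp add: div_eq_block[OF Q])
    qed (simp add: c_def)
    finally show "(\<Sum>u<m. c * (\<Sum>a<t. of_bool (f u a = i))) \<le> 1" using ctQ by simp
  qed (simp_all add: c_def)
  also have "(\<Sum>u<m. c * ((\<Sum>a<t. fcost (cfl_inst z Q) (f u a))
      + (\<Sum>a<t. \<Sum>b<Q. ccost (cfl_inst z Q) (f u a) (g u a b)))) = 1 / Q"
  proof -
    \<comment> \<open>Only the starting point \<open>z * Q\<close> belongs to the costly facility,
      so the cost is \<open>c * t\<close>.\<close>
    have one: "(\<Sum>v<m. of_bool (v div Q = z)) = (1::real)"
    proof -
      have "{..<m} \<inter> {v. v div Q = z} = {z * Q}"
        unfolding div_eq_block[OF Q] using Q by (auto simp: m_def)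
      then show ?thesis by simp
    qed
    have "(\<Sum>u<m. c * (\<Sum>a<t. of_bool (f u a = z))) = c * (\<Sum>a<t. \<Sum>u<m. of_bool (f u a = z))"
      unfolding sum_distrib_left[symmetric] by (subst sum.swap) rule
    also have "\<dots> = c * (\<Sum>a<t. \<Sum>v<m. of_bool (v div Q = z))"
      unfolding f_def using sum_rotate[where h = "\<lambda>v. of_bool (v div Q = z) :: real"]
      by (simp del: sum_of_bool_eq)
    also have "\<dots> = 1 / Q" using t by (simp add: one c_def del: sum_of_bool_eq)
    finally show ?thesis by (simp del: sum_of_bool_eq)
  qed
  finally show ?thesis .
qed

lemma gap_CFL:
  assumes R: "proper_relaxation CFL R" and cpl: "complexity_below_one CFL R"
  shows "integrality_gap CFL R = \<infinity>"
proof (rule integrality_gap_infinite[OF R])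
  fix c :: nat
  \<comment> \<open>The threshold of \<open>complexity_below_one\<close> itself serves as
    \<open>z\<close>, since the instance opens up to \<open>z + 1\<close> facilities.\<close>
  from cpl obtain z where z: "\<And>I. I \<in> instances CFL \<Longrightarrow> z \<le> max_open CFL I \<Longrightarrow> complexity CFL I (R I) < 1"
    by (auto simp: complexity_below_one_def)
  define Q where "Q = c + 1"
  let ?I = "cfl_inst z Q"
  have Q: "0 < Q" by (simp add: Q_def)
  have I: "?I \<in> instances CFL"
    using wf_cfl_inst[OF Q] block_solution_cfl[OF Q, of z] by (auto simp: instances_def)
  have C: "proper CFL ?I (R ?I)" using R I by (simp add: proper_relaxation_def)
  have "complexity CFL ?I (R ?I) < 1" using I by (rule z) (simp add: max_open_cfl[OF Q])
  from block_classes_mem[OF C block_solution_cfl[OF Q] max_open_cfl[OF Q] this _ Q]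
  obtain t where t: "1 \<le> t" "t \<le> z" "\<And>f g. blocks ?I t Q f g \<Longrightarrow> block_class t Q f g \<in> R ?I"
    by auto
  have "lp_opt ?I (R ?I) \<le> ereal (1 / Q)"
    using Q t(1,2) finite_proper[OF C] t(3) by (rule lp_opt_cfl_le)
  moreover have "ereal 1 \<le> int_opt CFL ?I" by (intro int_opt_ge class_cost_cfl_ge)
  ultimately show "\<exists>I A B. I \<in> instances CFL \<and> ereal A \<le> int_opt CFL I \<and> lp_opt I (R I) \<le> ereal B
      \<and> 0 < A \<and> 0 < B \<and> real c \<le> A / B"
    using I by (intro exI[of _ ?I] exI[of _ 1] exI[of _ "1 / real Q"]) (simp add: Q_def)
qed

section \<open>The lower-bounded instances\<close>

text \<open>
  With bound \<open>Suc q\<close>, client \<open>i * Suc q + b\<close> lies at facility \<open>i\<close> if \<open>b < q\<close>, and at a hub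
  (labelled \<open>z + 2\<close>) if \<open>b = q\<close>. Distinct locations are at distance 1.
\<close>

definition client_loc :: "nat \<Rightarrow> nat \<Rightarrow> nat \<Rightarrow> nat" where
  "client_loc z q j = (if j mod Suc q = q then z + 2 else j div Suc q)"

text \<open>The \<open>- 1\<close> drops the hub client of the last block: \<open>z + 1\<close> hub
  clients remain, and the clients are one too few to open all \<open>z + 2\<close>
  facilities.\<close>

definition lbfl_inst :: "nat \<Rightarrow> nat \<Rightarrow> inst" where
  "lbfl_inst z q = \<lparr>nfac = z + 2, ncli = (z + 2) * Suc q - 1, bnd = Suc q,
    fcost = (\<lambda>_. 0), ccost = (\<lambda>i j. of_bool (i \<noteq> client_loc z q j))\<rparr>"

lemma lbfl_inst_sel [simp]:
  "nfac (lbfl_inst z q) = z + 2" "ncli (lbfl_inst z q) = (z + 2) * Suc q - 1"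
  "bnd (lbfl_inst z q) = Suc q" "fcost (lbfl_inst z q) = (\<lambda>_. 0)"
  "ccost (lbfl_inst z q) = (\<lambda>i j. of_bool (i \<noteq> client_loc z q j))"
  by (simp_all add: lbfl_inst_def)

text \<open>The distance is the discrete metric pulled back along the location map, with facility
  \<open>i\<close> at location \<open>i\<close>.\<close>

lemma wf_lbfl_inst: "wf_inst (lbfl_inst z q)"
proof -
  let ?l = "case_sum id (client_loc z q)"
  have "metric_costs (lbfl_inst z q)"
    unfolding metric_costs_def
    by (rule exI[of _ "\<lambda>a b. of_bool (?l a \<noteq> ?l b)"]) (auto simp: of_bool_def)
  then show ?thesis by (simp add: wf_inst_def)
qed

lemma block_solution_lbfl:
  "block_solution (ncli (lbfl_inst z q)) z (Suc q) \<in> int_solutions LBFL (lbfl_inst z q)"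
proof (rule block_solution_mem)
  fix i assume i: "i \<le> z"
  have "{i * Suc q..<i * Suc q + Suc q}
      \<subseteq> {j. j < (z + 2) * Suc q - 1 \<and> i = min (j div Suc q) z}"
  proof
    fix j assume j: "j \<in> {i * Suc q..<i * Suc q + Suc q}"
    have "j div Suc q = i" using j div_eq_block[of "Suc q" i] by blast
    moreover have "i * Suc q \<le> z * Suc q" using i by (rule mult_le_mono1)
    then have "j < (z + 2) * Suc q - 1" using j by simp
    ultimately show "j \<in> {j. j < (z + 2) * Suc q - 1 \<and> i = min (j div Suc q) z}"
      using i by simp
  qed
  from card_mono[OF _ this]
  have "Suc q \<le> card {j. j < (z + 2) * Suc q - 1 \<and> i = min (j div Suc q) z}" by simp
  then show "load_ok LBFL (bnd (lbfl_inst z q))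
      (real (card {j. j < ncli (lbfl_inst z q) \<and> i = min (j div Suc q) z}))"
    by (simp add: load_ok_def del: mult_Suc_right)
qed simp

lemma card_facs_lbfl:
  assumes "s \<in> int_solutions LBFL (lbfl_inst z q)"
  shows "card (facs s) \<le> z + 1"
proof -
  have "card (facs s) * Suc q < (z + 2) * Suc q"
    using lower_bounds_le_clients[OF assms] by simp
  then have "card (facs s) < z + 2" by (simp only: mult_less_cancel2)
  then show ?thesis by simp
qed

lemma max_open_lbfl: "max_open LBFL (lbfl_inst z q) = z + 1"
  by (rule max_open_eqI[OF block_solution_lbfl])
    (simp_all add: facs_block_solution card_facs_lbfl[simplified])

lemma class_cost_lbfl_ge:
  assumes s: "s \<in> int_solutions LBFL (lbfl_inst z q)"
  shows "real q \<le> class_cost (lbfl_inst z q) s"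
proof -
  let ?I = "lbfl_inst z q"
  have cl: "is_class ?I s" using s by (rule int_solution_is_class)
  have "\<not> {..<z + 2} \<subseteq> facs s"
  proof
    assume "{..<z + 2} \<subseteq> facs s"
    moreover have "finite (facs s)" using facs_subset[OF cl] by (rule finite_subset) simp
    ultimately have "card {..<z + 2} \<le> card (facs s)" by (intro card_mono)
    then show False using card_facs_lbfl[OF s] by simp
  qed
  then obtain i where i: "i < z + 2" "i \<notin> facs s" by auto
  \<comment> \<open>These are the \<open>q\<close> clients located at the closed facility
    \<open>i\<close>; each is served from elsewhere and pays 1.\<close>
  let ?J = "{i * Suc q..<i * Suc q + q}"
  have "i * Suc q \<le> (z + 1) * Suc q" using i(1) by (intro mult_le_mono1) simp
  then have J: "?J \<subseteq> {..<ncli ?I}" by auto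
  have "real q = (\<Sum>j\<in>?J. 1)" by simp
  also have "\<dots> = (\<Sum>j\<in>?J. \<Sum>i'<nfac ?I. snd s i' j)"
    using s J by (intro sum.cong) (auto simp: int_solutions_def)
  also have "\<dots> = (\<Sum>j\<in>?J. \<Sum>i'<nfac ?I. snd s i' j * ccost ?I i' j)"
  proof (intro sum.cong refl)
    fix j i' assume "j \<in> ?J"
    then obtain b where b: "j = i * Suc q + b" "b < q"
      by (metis add_less_cancel_left atLeastLessThan_iff le_Suc_ex)
    then have "client_loc z q j = i"
      using mod_less[of b "Suc q"] div_less[of b "Suc q"]
      by (simp add: client_loc_def del: mult_Suc_right mod_less div_less)
    moreover have "snd s i j = 0"
      using agn_subset[OF cl] i(2) by (auto simp: snd_class[OF cl])
    ultimately show "snd s i' j = snd s i' j * ccost ?I i' j" by auto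
  qed
  also have "\<dots> \<le> (\<Sum>j<ncli ?I. \<Sum>i'<nfac ?I. snd s i' j * ccost ?I i' j)"
    using J by (intro sum_mono2) (auto intro!: sum_nonneg simp: snd_class[OF cl])
  also have "\<dots> = class_cost ?I s"
    unfolding class_cost_eq[OF cl] by (subst sum.swap) simp
  finally show ?thesis .
qed

section \<open>Admissible classes and averages over shifts\<close>

lemma div_mod_Suc_iff: "b < Suc q \<Longrightarrow> i * Suc q + b = j \<longleftrightarrow> i = j div Suc q \<and> b = j mod Suc q"
  by (metis add.commute add.right_neutral div_less div_mult_mod_eq div_mult_self3 mod_less mod_mult_self3 nat.simps(3))

text \<open>Shared by both families of classes. Condition \<open>out\<close> makes every extra
  client \<open>e a\<close> a hub client or a client in the block of a facility that is not opened,
  so it never collides with clients served at their own location.\<close>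

lemma blocks_lbfl:
  assumes e: "inj_on e {..<t}" "\<And>a. a < t \<Longrightarrow> e a < (z + 2) * Suc q - 1"
    and out: "\<And>a a'. a < t \<Longrightarrow> a' < t \<Longrightarrow> e a mod Suc q = q \<or> e a div Suc q \<noteq> (u + a') mod (z + 2)"
    and t: "t \<le> z"
  shows "blocks (lbfl_inst z q) t (Suc q) (\<lambda>a. (u + a) mod (z + 2))
    (\<lambda>a b. if b < q then (u + a) mod (z + 2) * Suc q + b else e a)"
  unfolding blocks_def
proof (intro conjI allI impI)
  have inj: "a = a'" if "a < t" "a' < t" "(u + a) mod (z + 2) = (u + a') mod (z + 2)" for a a'
    by (rule add_mod_inj[where c = u and m = "z + 2"]) (use that t in \<open>simp_all add: add.commute\<close>)
  show "inj_on (\<lambda>a. (u + a) mod (z + 2)) {..<t}"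
    using inj by (intro inj_onI) simp
  show "(u + a) mod (z + 2) < nfac (lbfl_inst z q)" for a by simp
  let ?g = "\<lambda>a b. if b < q then (u + a) mod (z + 2) * Suc q + b else e a"
  have loc: "?g a b div Suc q = (u + a) mod (z + 2)" "?g a b mod Suc q = b" if "b < q" for a b
    using div_mod_Suc_iff[of b q "(u + a) mod (z + 2)" "?g a b"] that by simp_all
  show "inj_on (\<lambda>(a, b). ?g a b) ({..<t} \<times> {..<Suc q})"
  proof (rule inj_onI)
    fix x y assume xy: "x \<in> {..<t} \<times> {..<Suc q}" "y \<in> {..<t} \<times> {..<Suc q}"
      "(\<lambda>(a, b). ?g a b) x = (\<lambda>(a, b). ?g a b) y"
    obtain a b a' b' where x: "x = (a, b)" and y: "y = (a', b')" by (cases x, cases y)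
    have *: "a \<in> {..<t}" "b \<in> {..<Suc q}" "a' \<in> {..<t}" "b' \<in> {..<Suc q}"
      using xy(1,2) by (auto simp: x y)
    have eq: "?g a b = ?g a' b'" using xy(3) by (simp only: x y prod.case)
    consider "b < q" "b' < q" | "b < q" "b' = q" | "b = q" "b' < q" | "b = q" "b' = q"
      using * by fastforce
    then have "a = a' \<and> b = b'"
    proof cases
      case 1
      then show ?thesis using eq loc[of b a] loc[of b' a'] inj[of a a'] * by simp
    next
      case 2
      then show ?thesis using eq loc[of b a] out[of a' a] * by auto
    next
      case 3
      then show ?thesis using eq loc[of b' a'] out[of a a'] * by auto
    next
      case 4
      then show ?thesis using eq e(1) * by (auto simp: inj_on_def)
    qed
    then show "x = y" by (simp add: x y)
  qed
  show "?g a b < ncli (lbfl_inst z q)" if "a < t" "b < Suc q" for a b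
  proof (cases "b < q")
    case True
    have "(u + a) mod (z + 2) \<le> z + 1"
      using mod_less_divisor[of "z + 2" "u + a"] by linarith
    then have "(u + a) mod (z + 2) * Suc q \<le> (z + 1) * Suc q" by (rule mult_le_mono1)
    then show ?thesis using True by simp
  qed (use e(2) that in simp)
qed

lemma sum_Plus_Times:
  "finite A \<Longrightarrow> finite B \<Longrightarrow> finite B' \<Longrightarrow>
    (\<Sum>x\<in>(A \<times> B) <+> (A \<times> B'). F x)
      = (\<Sum>u\<in>A. \<Sum>r\<in>B. F (Inl (u, r))) + (\<Sum>u\<in>A. \<Sum>r\<in>B'. F (Inr (u, r)) :: real)"
  by (simp add: sum.Plus sum.cartesian_product case_prod_unfold)

lemma sum_rotate_fst:
  "(\<Sum>u<p. \<Sum>r<n. \<Sum>a<t. h ((u + a) mod p)) = real n * real t * (\<Sum>v<(p::nat). h v)"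
proof -
  have "(\<Sum>u<p. \<Sum>r<n. \<Sum>a<t. h ((u + a) mod p)) = real n * (\<Sum>a<t. \<Sum>u<p. h ((u + a) mod p))"
    by (simp add: sum_distrib_left[symmetric] sum.swap[of _ "{..<t}"])
  then show ?thesis by (simp add: sum_rotate)
qed

lemma sum_rotate_snd:
  "(\<Sum>u<p. \<Sum>r<n. \<Sum>a<t. h ((r + a) mod n)) = real p * real t * (\<Sum>v<(n::nat). h v)"
proof -
  have "(\<Sum>u<p. \<Sum>r<n. \<Sum>a<t. h ((r + a) mod n)) = real p * (\<Sum>a<t. \<Sum>r<n. h ((r + a) mod n))"
    by (simp add: sum.swap[of _ "{..<t}"])
  then show ?thesis by (simp add: sum_rotate)
qed

text \<open>\<open>u\<close> and \<open>r\<close> vary independently, so for each \<open>a\<close>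
  the double sum is a product of two rotated sums.\<close>

lemma sum_rotate_both:
  "(\<Sum>u<p. \<Sum>r<n. \<Sum>a<t. h ((u + d) mod p) * l ((r + a) mod n))
    = real t * (\<Sum>v<(p::nat). h v) * (\<Sum>v<(n::nat). l v)"
proof -
  have "(\<Sum>u<p. \<Sum>r<n. \<Sum>a<t. h ((u + d) mod p) * l ((r + a) mod n))
      = (\<Sum>u<p. h ((u + d) mod p) * (\<Sum>a<t. \<Sum>r<n. l ((r + a) mod n)))"
    by (simp add: sum_distrib_left sum.swap[of _ "{..<t}"])
  then show ?thesis by (simp add: sum_rotate sum_distrib_right[symmetric] sum_rotate[where c = d and h = h])
qed

text \<open>
  The classes open \<open>t\<close> cyclically consecutive facilities, each serving the \<open>q\<close> clients at its
  own location and one more: a hub client (\<open>eA\<close>, weight \<open>\<alpha>\<close>), or a client located at the next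
  closed facility (\<open>eB\<close>, weight \<open>\<beta>\<close>). The weights are determined by full coverage of the hub
  clients and of the other clients.
\<close>

lemma lp_opt_lbfl_le:
  assumes t: "1 \<le> t" "t \<le> z" "t \<le> q" and fin: "finite C"
    and mem: "\<And>f g. blocks (lbfl_inst z q) t (Suc q) f g \<Longrightarrow> block_class t (Suc q) f g \<in> C"
  shows "lp_opt (lbfl_inst z q) C \<le> ereal (z + 2)"
proof -
  let ?I = "lbfl_inst z q"
  \<comment> \<open>\<open>p\<close> counts the facilities and \<open>n\<close> the hub
    clients.\<close>
  define p where "p = z + 2"
  define n where "n = z + 1"
  define G where "G u e a b = (if b < q then (u + a) mod p * Suc q + b else e a)" for u e and a b :: nat
  define eA where "eA r a = (r + a) mod n * Suc q + q" for r a
  define eB where "eB u r a = (u + t) mod p * Suc q + (r + a) mod q" for u r a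
  define f where "f = case_sum (\<lambda>(u, r :: nat) a. (u + a) mod p) (\<lambda>(u, r :: nat) a. (u + a) mod p)"
  define g where "g = case_sum (\<lambda>(u, r). G u (eA r)) (\<lambda>(u, r). G u (eB u r))"
  \<comment> \<open>A hub client is reached by \<open>p * t\<close> triples
    \<open>(u, r, a)\<close>, all in the first family, which fixes \<open>\<alpha>\<close>. Any
    other client is covered \<open>n * t\<close> times by the first family and
    \<open>q * t + t\<close> times by the second, at its own location and as an extra client. Hence
    \<open>\<beta> * t * Suc q\<close> must equal \<open>1 - n / p = 1 / p\<close>.\<close>
  define \<alpha> where "\<alpha> = 1 / (real p * real t)"
  define \<beta> where "\<beta> = 1 / (real p * real t * real (Suc q))"
  define c where "c = case_sum (\<lambda>_::nat \<times> nat. \<alpha>) (\<lambda>_::nat \<times> nat. \<beta>)"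
  define K where "K = ({..<p} \<times> {..<n}) <+> ({..<p} \<times> {..<q})"
  have pos: "0 < p" "0 < n" "0 < q" "p = Suc n" "t < n" using t by (simp_all add: p_def n_def)
  have sumK: "(\<Sum>x\<in>K. c x * F x) = \<alpha> * (\<Sum>u<p. \<Sum>r<n. F (Inl (u, r))) + \<beta> * (\<Sum>u<p. \<Sum>r<q. F (Inr (u, r)))"
    for F
    unfolding K_def by (subst sum_Plus_Times) (simp_all add: c_def sum_distrib_left)
  have ab: "\<alpha> * (real p * real t) = 1" "\<beta> * (real p * real t * real (Suc q)) = 1"
    "0 \<le> \<alpha>" "0 \<le> \<beta>"
    using pos t by (simp_all add: \<alpha>_def \<beta>_def del: of_nat_Suc)
  have \<beta>\<alpha>: "\<beta> * (real t * real (Suc q)) = \<alpha> * real t"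
    using pos t by (simp add: \<alpha>_def \<beta>_def del: of_nat_Suc)
  have pn: "real p = real n + 1" using pos by simp
  have blk: "blocks ?I t (Suc q) (f x) (g x)" if x: "x \<in> K" for x
  proof (cases x)
    case (Inl y)
    obtain u r where y: "y = (u, r)" by (cases y)
    have "blocks ?I t (Suc q) (\<lambda>a. (u + a) mod p) (G u (eA r))"
      unfolding p_def G_def
    proof (rule blocks_lbfl)
      show "inj_on (eA r) {..<t}"
      proof (rule inj_onI)
        fix a a' assume "a \<in> {..<t}" "a' \<in> {..<t}" "eA r a = eA r a'"
        then show "a = a'"
          using pos add_mod_inj[of a r n a'] by (simp add: eA_def add.commute del: mult_Suc_right)
      qed
      show "eA r a < (z + 2) * Suc q - 1" for a
      proof -
        have "(r + a) mod n \<le> z" using pos mod_less_divisor[of n "r + a"] by (simp add: n_def)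
        then have "(r + a) mod n * Suc q \<le> z * Suc q" by (rule mult_le_mono1)
        then show ?thesis by (simp add: eA_def)
      qed
    qed (use t in \<open>simp_all add: eA_def del: mult_Suc_right\<close>)
    then show ?thesis by (simp add: Inl y f_def g_def)
  next
    case (Inr y)
    obtain u r where y: "y = (u, r)" by (cases y)
    have small: "(r + a) mod q < q" for a using pos by simp
    have "blocks ?I t (Suc q) (\<lambda>a. (u + a) mod p) (G u (eB u r))"
      unfolding p_def G_def
    proof (rule blocks_lbfl)
      show "inj_on (eB u r) {..<t}"
      proof (rule inj_onI)
        \<comment> \<open>All extra clients share one location with \<open>q\<close> clients;
          \<open>t <= q\<close> keeps them distinct.\<close>
        fix a a' assume "a \<in> {..<t}" "a' \<in> {..<t}" "eB u r a = eB u r a'"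
        then show "a = a'"
          using t add_mod_inj[of a r q a'] by (simp add: eB_def add.commute del: mult_Suc_right)
      qed
      show "eB u r a < (z + 2) * Suc q - 1" for a
      proof -
        have "(u + t) mod p \<le> z + 1" using pos mod_less_divisor[of p "u + t"] by (simp add: p_def)
        then have "(u + t) mod p * Suc q \<le> (z + 1) * Suc q" by (rule mult_le_mono1)
        then show ?thesis using small[of a] by (simp add: eB_def)
      qed
      \<comment> \<open>The open facilities have offsets below \<open>t\<close> from
        \<open>u\<close>; as \<open>t < p\<close>, offset \<open>t\<close> is not among
        them.\<close>
      show "eB u r a mod Suc q = q \<or> eB u r a div Suc q \<noteq> (u + a') mod (z + 2)"
        if "a' < t" for a a'
      proof -
        have "eB u r a div Suc q = (u + t) mod p"
          using small[of a] div_mod_Suc_iff[of "(r + a) mod q" q "(u + t) mod p" "eB u r a"]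
          by (simp add: eB_def)
        moreover have "(u + t) mod p \<noteq> (u + a') mod p"
          using add_mod_inj[of t u p a'] that pos by (auto simp: add.commute)
        ultimately show ?thesis by (simp add: p_def)
      qed
    qed (use t in simp)
    then show ?thesis by (simp add: Inr y f_def g_def)
  qed
  have "lp_opt ?I C \<le> ereal (\<Sum>x\<in>K. c x * ((\<Sum>a<t. fcost ?I (f x a))
      + (\<Sum>a<t. \<Sum>b<Suc q. ccost ?I (f x a) (g x a b))))"
  proof (rule lp_opt_le_blocks[OF _ fin mem blk])
    fix j assume j: "j < ncli ?I"
    define jd where "jd = j div Suc q"
    \<comment> \<open>\<open>L\<close> is 1 for a client at a facility and 0 for a hub client, so
      one computation treats both kinds.\<close>
    define L :: real where "L = of_bool (j mod Suc q < q)"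
    have jd: "jd < p"
    proof -
      have "j < p * Suc q" using j by (simp add: p_def)
      then show ?thesis unfolding jd_def by (rule less_mult_imp_div_less)
    qed
    \<comment> \<open>The last block has no hub client.\<close>
    have hub: "jd < n" if "j mod Suc q = q"
    proof (rule ccontr)
      assume "\<not> jd < n"
      then have "n * Suc q \<le> jd * Suc q" by (intro mult_le_mono1) simp
      moreover have "jd * Suc q + q = j" using that div_mult_mod_eq[of j "Suc q"] by (simp add: jd_def)
      ultimately show False using j by (simp add: n_def)
    qed
    have split: "(\<Sum>b<Suc q. of_bool (G u e a b = j))
        = L * of_bool ((u + a) mod p = jd) + (of_bool (e a = j) :: real)" for u a and e :: "nat \<Rightarrow> nat"
    proof -
      have "(\<Sum>b<q. of_bool (G u e a b = j) :: real)
          = (\<Sum>b<q. if b = j mod Suc q then of_bool ((u + a) mod p = jd) else 0)"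
        using div_mod_Suc_iff by (intro sum.cong refl) (auto simp: G_def jd_def simp del: mult_Suc_right)
      also have "\<dots> = L * of_bool ((u + a) mod p = jd)"
        by (simp add: L_def)
      finally show ?thesis by (simp add: G_def del: sum_of_bool_eq)
    qed
    have delta: "(\<Sum>v<m. of_bool (v = w)) = (of_bool (w < m) :: real)" for m w :: nat
      by (simp add: of_bool_def sum.delta del: sum_of_bool_eq)
    have eA: "of_bool (eA r a = j) = (1 - L) * of_bool ((r + a) mod n = jd)" for r a
      using div_mod_Suc_iff[of q q "(r + a) mod n" j] mod_less_divisor[of "Suc q" j]
      by (auto simp: eA_def L_def jd_def of_bool_def simp del: mult_Suc_right mod_less_divisor)
    have A: "(\<Sum>u<p. \<Sum>r<n. \<Sum>a<t. \<Sum>b<Suc q. of_bool (g (Inl (u, r)) a b = j))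
        = real t * (real n * L + real p * (1 - L))"
    proof -
      have "(\<Sum>u<p. \<Sum>r<n. \<Sum>a<t. \<Sum>b<Suc q. of_bool (g (Inl (u, r)) a b = j))
        = L * (\<Sum>u<p. \<Sum>r<n. \<Sum>a<t. of_bool ((u + a) mod p = jd))
          + (1 - L) * (\<Sum>u<p. \<Sum>r<n. \<Sum>a<t. of_bool ((r + a) mod n = jd))"
        by (simp only: g_def sum.case prod.case split eA sum.distrib sum_distrib_left)
      also have "\<dots> = L * (real n * real t * of_bool (jd < p)) + (1 - L) * (real p * real t * of_bool (jd < n))"
        by (simp only: sum_rotate_fst[where h = "\<lambda>v. of_bool (v = jd)"]
            sum_rotate_snd[where h = "\<lambda>v. of_bool (v = jd)"] delta)
      also have "(1 - L) * (real p * real t * of_bool (jd < n)) = (1 - L) * (real p * real t)"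
      proof (cases "j mod Suc q = q")
        case False
        then have "L = 1" using mod_less_divisor[of "Suc q" j] by (simp add: L_def del: mod_less_divisor)
        then show ?thesis by simp
      qed (use hub in simp)
      finally show ?thesis using jd by (simp add: algebra_simps)
    qed
    have eB: "of_bool (eB u r a = j) = of_bool ((u + t) mod p = jd) * (of_bool ((r + a) mod q = j mod Suc q) :: real)"
      for u r a
      using div_mod_Suc_iff[of "(r + a) mod q" q "(u + t) mod p" j] pos
      by (simp add: eB_def jd_def less_SucI del: mult_Suc_right)
    have B: "(\<Sum>u<p. \<Sum>r<q. \<Sum>a<t. \<Sum>b<Suc q. of_bool (g (Inr (u, r)) a b = j))
        = real t * real (Suc q) * L"
    proof -
      have "(\<Sum>u<p. \<Sum>r<q. \<Sum>a<t. \<Sum>b<Suc q. of_bool (g (Inr (u, r)) a b = j))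
        = L * (\<Sum>u<p. \<Sum>r<q. \<Sum>a<t. of_bool ((u + a) mod p = jd))
          + (\<Sum>u<p. \<Sum>r<q. \<Sum>a<t. of_bool ((u + t) mod p = jd) * (of_bool ((r + a) mod q = j mod Suc q) :: real))"
        by (simp only: g_def sum.case prod.case split eB sum.distrib sum_distrib_left)
      also have "\<dots> = L * (real q * real t * of_bool (jd < p)) + real t * of_bool (jd < p) * L"
        by (simp only: sum_rotate_fst[where h = "\<lambda>v. of_bool (v = jd)"] delta L_def
            sum_rotate_both[where h = "\<lambda>v. of_bool (v = jd)" and l = "\<lambda>v. of_bool (v = j mod Suc q)"])
      finally show ?thesis using jd by (simp add: algebra_simps)
    qed
    have "(\<Sum>x\<in>K. c x * (\<Sum>a<t. \<Sum>b<Suc q. of_bool (g x a b = j)))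
        = \<alpha> * (real t * (real n * L + real p * (1 - L))) + \<beta> * (real t * real (Suc q) * L)"
      unfolding sumK A B ..
    also have "\<dots> = 1"
    proof -
      from \<beta>\<alpha> have "\<beta> * (real t * real (Suc q) * L) = \<alpha> * real t * L"
        by (metis mult.assoc)
      moreover from pn have "\<alpha> * (real t * (real n * L + real p * (1 - L))) + \<alpha> * real t * L
          = \<alpha> * (real p * real t)"
        by (simp add: algebra_simps)
      ultimately have "\<alpha> * (real t * (real n * L + real p * (1 - L))) + \<beta> * (real t * real (Suc q) * L)
          = \<alpha> * (real p * real t)"
        by (simp only:)
      then show ?thesis using ab by simp
    qed
    finally show "(\<Sum>x\<in>K. c x * (\<Sum>a<t. \<Sum>b<Suc q. of_bool (g x a b = j))) = 1" .
  next
    fix i assume "i < nfac ?I"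
    then have "(\<Sum>v<p. of_bool (v = i)) = (1::real)"
      by (simp add: p_def of_bool_def sum.delta del: sum_of_bool_eq)
    then have "(\<Sum>x\<in>K. c x * (\<Sum>a<t. of_bool (f x a = i))) = \<alpha> * (real n * real t) + \<beta> * (real q * real t)"
      unfolding sumK
      by (simp only: f_def sum.case prod.case sum_rotate_fst[where h = "\<lambda>v. of_bool (v = i)"] mult_1_right)
    \<comment> \<open>Rounding \<open>q\<close> up to \<open>Suc q\<close> turns the second term
      into \<open>1 / p\<close>, which complements \<open>n / p\<close> to 1.\<close>
    also have "\<dots> \<le> \<alpha> * (real n * real t) + \<beta> * (real (Suc q) * real t)"
      using ab by (intro add_left_mono mult_left_mono mult_right_mono) auto
    also have "\<dots> = \<alpha> * (real n * real t) + \<alpha> * real t"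
      unfolding \<beta>\<alpha>[symmetric] by (simp only: mult.commute)
    also have "\<dots> = \<alpha> * (real p * real t)"
      unfolding pn by (simp add: algebra_simps)
    finally show "(\<Sum>x\<in>K. c x * (\<Sum>a<t. of_bool (f x a = i))) \<le> 1" using ab by simp
  next
    show "0 \<le> c x" for x using ab by (cases x) (auto simp: c_def)
  qed (simp_all add: K_def)
  also have "\<dots> \<le> ereal (z + 2)"
  proof -
    \<comment> \<open>Only the extra client, at \<open>b = q\<close>, can pay, and it pays at most
      1.\<close>
    have cost: "(\<Sum>a<t. \<Sum>b<Suc q. ccost ?I ((u + a) mod p) (G u e a b)) \<le> real t" for u e
    proof -
      have "(\<Sum>b<Suc q. ccost ?I ((u + a) mod p) (G u e a b)) \<le> 1" for a
      proof -
        have "ccost ?I ((u + a) mod p) (G u e a b) = 0" if "b < q" for b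
          using that div_mod_Suc_iff[of b q "(u + a) mod p" "G u e a b"]
          by (simp add: G_def client_loc_def del: mult_Suc_right)
        then have "(\<Sum>b<q. ccost ?I ((u + a) mod p) (G u e a b)) = 0" by (intro sum.neutral) blast
        then show ?thesis by simp
      qed
      then have "(\<Sum>a<t. \<Sum>b<Suc q. ccost ?I ((u + a) mod p) (G u e a b)) \<le> (\<Sum>a<t. 1)"
        by (intro sum_mono)
      then show ?thesis by simp
    qed
    have "(\<Sum>x\<in>K. c x * ((\<Sum>a<t. fcost ?I (f x a)) + (\<Sum>a<t. \<Sum>b<Suc q. ccost ?I (f x a) (g x a b))))
        \<le> \<alpha> * (\<Sum>u<p. \<Sum>r<n. real t) + \<beta> * (\<Sum>u<p. \<Sum>r<q. real t)"
      unfolding sumK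
      by (intro add_mono mult_left_mono sum_mono ab)
        (use cost in \<open>simp_all only: f_def g_def sum.case prod.case lbfl_inst_sel sum.neutral_const add_0\<close>)
    also have "\<dots> = \<alpha> * (real p * real t) * real n + \<beta> * (real p * real t * real q)" by simp
    also have "\<dots> \<le> \<alpha> * (real p * real t) * real n + \<beta> * (real p * real t * real (Suc q))"
      using ab by (intro add_left_mono mult_left_mono) auto
    also have "\<dots> = z + 2" unfolding ab by (simp add: n_def)
    finally show ?thesis by simp
  qed
  finally show ?thesis .
qed

lemma gap_LBFL:
  assumes R: "proper_relaxation LBFL R" and cpl: "complexity_below_one LBFL R"
  shows "integrality_gap LBFL R = \<infinity>"
proof (rule integrality_gap_infinite[OF R])
  fix c :: nat
  from cpl obtain z where z: "\<And>I. I \<in> instances LBFL \<Longrightarrow> z \<le> max_open LBFL I \<Longrightarrow> complexity LBFL I (R I) < 1"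
    by (auto simp: complexity_below_one_def)
  \<comment> \<open>The ratio \<open>q / (z + 2)\<close> becomes \<open>c + 1\<close>, and
    \<open>q\<close> is at least \<open>z\<close>, as the extra clients of the second family
    require.\<close>
  define q where "q = (c + 1) * (z + 2)"
  let ?I = "lbfl_inst z q"
  have I: "?I \<in> instances LBFL"
    using wf_lbfl_inst block_solution_lbfl[of z q] by (auto simp: instances_def)
  have C: "proper LBFL ?I (R ?I)" using R I by (simp add: proper_relaxation_def)
  have "complexity LBFL ?I (R ?I) < 1" using I by (rule z) (simp add: max_open_lbfl[simplified])
  from block_classes_mem[OF C block_solution_lbfl max_open_lbfl this]
  obtain t where t: "1 \<le> t" "t \<le> z"
    "\<And>f g. blocks ?I t (Suc q) f g \<Longrightarrow> block_class t (Suc q) f g \<in> R ?I"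
    by auto
  have "t \<le> q" using t(2) by (simp add: q_def)
  have "lp_opt ?I (R ?I) \<le> ereal (z + 2)"
    using t(1,2) \<open>t \<le> q\<close> finite_proper[OF C] t(3) by (rule lp_opt_lbfl_le)
  moreover have "ereal q \<le> int_opt LBFL ?I" by (intro int_opt_ge class_cost_lbfl_ge)
  moreover have "0 < q" "real c \<le> real q / real (z + 2)" by (simp_all add: q_def field_simps)
  ultimately have "?I \<in> instances LBFL \<and> ereal (real q) \<le> int_opt LBFL ?I
      \<and> lp_opt ?I (R ?I) \<le> ereal (real (z + 2))
      \<and> 0 < real q \<and> 0 < real (z + 2) \<and> real c \<le> real q / real (z + 2)"
    using I by simp
  then show "\<exists>I A B. I \<in> instances LBFL \<and> ereal A \<le> int_opt LBFL I \<and> lp_opt I (R I) \<le> ereal B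
      \<and> 0 < A \<and> 0 < B \<and> real c \<le> A / B"
    by blast
qed

theorem theorem3:
  fixes k :: variant
  shows "(\<forall>R. proper_relaxation k R \<and> complexity_below_one k R \<longrightarrow> integrality_gap k R = \<infinity>) \<and>
    (\<exists>R. proper_relaxation k R \<and> complexity_one k R \<and>
      (\<forall>I\<in>instances k. lp_projection I (R I) = integral_polytope k I))"
proof (intro conjI allI impI)
  fix R assume "proper_relaxation k R \<and> complexity_below_one k R"
  then show "integrality_gap k R = \<infinity>" using gap_CFL gap_LBFL by (cases k) auto
next
  show "\<exists>R. proper_relaxation k R \<and> complexity_one k R \<and>
      (\<forall>I\<in>instances k. lp_projection I (R I) = integral_polytope k I)"
    by (rule exI[of _ "int_solutions k"])
      (auto simp: proper_relaxation_def complexity_one_def complexity_int_solutions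
        proper_int_solutions lp_projection_int_solutions, auto simp: instances_def
        proper_int_solutions lp_projection_int_solutions)
qed

end
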